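(* Let $m\ge 1$ be an integer. Then: (i) there exist infinitely many $U_m$-numbers $\xi$ such that for every positive divisor $d$ of $m$ there is a positive integer $k$ such that $\xi^k$ is a $U_d$-number; (ii) there exist infinitely many $U_m$-numbers $\xi$ such that $\xi^k$ is a $U_m$-number for all integers $k\ge 1$.
   Context: For an algebraic number $\alpha$, the height $H(\alpha)$ is the maximum of the absolute values of the coefficients of the minimal polynomial of $\alpha$ over $\mathbb{Z}$ (primitive integer polynomial). For a real number $\xi$ and an integer $n\ge 1$, $\omega_n^*(\xi)$ denotes the supremum of the positive real numbers $\omega^*$ for which there exist infinitely many real algebraic numbers $\alpha$ of degree exactly $n$ with $0<|\xi-\alpha|<H(\alpha)^{-\omega^*-1}$ (the supremum is $0$ if there is no such $\omega^*$). A real number $\xi$ is a $U_m$-number if $\omega_m^*(\xi)=\infty$ and $\omega_n^*(\xi)<\infty$ for all $1\le n<m$. *)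

theory Defs
  imports "HOL-Library.Extended_Real" "HOL-Computational_Algebra.Computational_Algebra"
begin

definition is_min_int_poly :: "int poly \<Rightarrow> 'a :: field_char_0 \<Rightarrow> bool" where
  "is_min_int_poly p \<alpha> \<longleftrightarrow>
     p \<noteq> 0 \<and> poly (map_poly of_int p) \<alpha> = 0 \<and>
     (\<forall>q. q \<noteq> 0 \<and> poly (map_poly of_int q) \<alpha> = 0 \<longrightarrow> degree p \<le> degree q) \<and>
     content p = 1 \<and> lead_coeff p > 0"

lemma is_min_int_poly_unique:
  fixes \<alpha> :: "'a :: field_char_0"
  assumes p: "is_min_int_poly p \<alpha>" and q: "is_min_int_poly q \<alpha>"
  shows "p = q"
proof -
  have deg: "degree p = degree q"
    using p q by (auto simp: is_min_int_poly_def intro: antisym)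
  define r where "r = smult (lead_coeff q) p - smult (lead_coeff p) q"
  have "r = 0"
  proof (rule ccontr)
    assume nz: "r \<noteq> 0"
    have "map_poly of_int r = smult (of_int (lead_coeff q)) (map_poly of_int p) -
            smult (of_int (lead_coeff p)) (map_poly of_int q :: 'a poly)"
      by (rule poly_eqI) (simp add: r_def coeff_map_poly)
    hence "poly (map_poly of_int r) \<alpha> = 0"
      using p q by (simp add: is_min_int_poly_def)
    hence "degree p \<le> degree r"
      using p nz by (auto simp: is_min_int_poly_def)
    moreover have "degree r \<le> degree p"
      unfolding r_def using deg by (intro degree_diff_le) (auto intro: degree_smult_le[THEN order_trans])
    ultimately have "lead_coeff r = coeff r (degree p)" by simp
    also have "\<dots> = 0" by (simp add: r_def deg)
    finally show False using nz by simp
  qed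
  hence eq: "smult (lead_coeff q) p = smult (lead_coeff p) q" by (simp add: r_def)
  hence "content (smult (lead_coeff q) p) = content (smult (lead_coeff p) q)" by simp
  hence "lead_coeff q = lead_coeff p"
    using p q by (simp add: is_min_int_poly_def)
  hence "smult (lead_coeff p) (p - q) = 0" using eq by (simp add: smult_diff_right)
  thus ?thesis using p by (simp add: is_min_int_poly_def)
qed

lemma is_min_int_poly_exists:
  fixes \<alpha> :: "'a :: field_char_0"
  assumes "algebraic \<alpha>"
  shows "\<exists>p. is_min_int_poly p \<alpha>"
proof -
  define S where "S = (\<lambda>q. q \<noteq> 0 \<and> poly (map_poly of_int q) \<alpha> = 0)"
  obtain q0 where "S q0" using algebraicE'[OF assms] unfolding S_def by metis
  then obtain q where q: "S q" and min: "\<And>r. S r \<Longrightarrow> degree q \<le> degree r"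
    using ex_has_least_nat[of S q0 degree] by blast
  define c where "c = sgn (lead_coeff q)"
  have nz: "q \<noteq> 0" using q by (simp add: S_def)
  define p where "p = smult c (primitive_part q)"
  have c: "c = 1 \<or> c = -1" using nz by (auto simp: c_def sgn_if)
  have qp: "q = smult (content q) (primitive_part q)" by simp
  have pos: "content q > 0"
    using nz normalize_content[of q] by (metis abs_ge_zero content_eq_zero_iff normalize_int_def order_le_less)
  have "map_poly of_int q = (smult (of_int (content q)) (map_poly of_int (primitive_part q)) :: 'a poly)"
    by (subst qp, rule poly_eqI) (simp only: coeff_map_poly coeff_smult of_int_mult of_int_0)
  hence root: "poly (map_poly of_int (primitive_part q)) \<alpha> = 0"
    using q pos unfolding S_def by (metis mult_eq_0_iff of_int_eq_0_iff order_less_irrefl poly_smult)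
  have "map_poly of_int p = (smult (of_int c) (map_poly of_int (primitive_part q)) :: 'a poly)"
    by (rule poly_eqI) (simp add: p_def coeff_map_poly)
  hence "poly (map_poly of_int p) \<alpha> = 0" using root by simp
  moreover have "degree p = degree q" using c nz by (auto simp: p_def)
  moreover have "content p = 1" using c nz by (auto simp: p_def)
  moreover have "lead_coeff p > 0"
  proof -
    have "lead_coeff q = content q * lead_coeff (primitive_part q)"
      using arg_cong[OF qp, of lead_coeff] by (simp only: lead_coeff_smult)
    hence "c = sgn (lead_coeff (primitive_part q))"
      using pos by (simp add: c_def sgn_mult)
    moreover have "lead_coeff (primitive_part q) \<noteq> 0"
      using nz unfolding leading_coeff_0_iff by simp
    ultimately have "c * lead_coeff (primitive_part q) > 0" by (metis sgn_mult_self_eq sgn_mult sgn_greater sgn_1_pos zero_neq_one sgn_eq_0_iff abs_sgn zero_less_abs_iff mult.commute)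
    thus ?thesis by (simp only: p_def lead_coeff_smult)
  qed
  ultimately have "is_min_int_poly p \<alpha>"
    using min unfolding is_min_int_poly_def S_def by force
  thus ?thesis ..
qed

text \<open>
  Only meaningful for algebraic \<open>\<alpha>\<close>; for these the description is satisfied by exactly
  one polynomial, by the two lemmas above.
\<close>
definition min_int_poly :: "'a :: field_char_0 \<Rightarrow> int poly" where
  "min_int_poly \<alpha> = (THE p. is_min_int_poly p \<alpha>)"

lemma min_int_poly:
  assumes "algebraic \<alpha>"
  shows "is_min_int_poly (min_int_poly \<alpha>) \<alpha>"
  unfolding min_int_poly_def
  using is_min_int_poly_exists[OF assms] is_min_int_poly_unique by (metis theI)

definition alg_degree :: "'a :: field_char_0 \<Rightarrow> nat" where
  "alg_degree \<alpha> = degree (min_int_poly \<alpha>)"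

definition alg_height :: "'a :: field_char_0 \<Rightarrow> int" where
  "alg_height \<alpha> = Max (abs ` set (coeffs (min_int_poly \<alpha>)))"

text \<open>
  The element \<open>0\<close> implements the convention that the supremum is \<open>0\<close> if there is
  no admissible exponent (\<open>Sup {} = -\<infinity>\<close> in \<^typ>\<open>ereal\<close>); as all admissible exponents
  are positive, it has no effect otherwise.
\<close>
definition omega_star :: "nat \<Rightarrow> real \<Rightarrow> ereal" where
  "omega_star n \<xi> =
     Sup (insert 0 (ereal ` {w. w > 0 \<and>
       infinite {\<alpha> :: real. algebraic \<alpha> \<and> alg_degree \<alpha> = n \<and>
         0 < \<bar>\<xi> - \<alpha>\<bar> \<and> \<bar>\<xi> - \<alpha>\<bar> < real_of_int (alg_height \<alpha>) powr (- w - 1)}}))"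

definition U_number :: "nat \<Rightarrow> real \<Rightarrow> bool" where
  "U_number m \<xi> \<longleftrightarrow>
     m \<ge> 1 \<and> omega_star m \<xi> = \<infinity> \<and> (\<forall>n. 1 \<le> n \<and> n < m \<longrightarrow> omega_star n \<xi> < \<infinity>)"

end

(* Take \<xi> = \<alpha> L with L a positive Liouville number and \<alpha> > 0 an algebraic integer of degree m. Then
   \<xi>^k = \<alpha>^k L^k, and multiplying \<alpha>^k by powers of the convergents of L gives approximations of degree
   d = deg(\<alpha>^k) that are good enough for omega*_d = \<infinity>. Conversely, a nonzero integer polynomial of
   degree < d takes a value at \<alpha>^k that is bounded below polynomially in its height, so numbers of
   smaller degree stay away from these approximations; as the denominators q_j of the convergents
   satisfy q_{j+1} = q_j^{j+1}, a suitable choice of j bounds omega*_n for n < d.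
   Thus \<xi>^k is a U-number of type deg(\<alpha>^k). For (i) take \<alpha> = 2^{1/m}; for (ii) take a root \<alpha> of an
   Eisenstein polynomial with m distinct positive roots, so that all powers of \<alpha> have degree m.
   Shifting L by integers yields infinitely many examples. *)
theory Submission
  imports Defs "Jordan_Normal_Form.Char_Poly"
begin

section \<open>Minimal polynomials and heights\<close>

abbreviation ieval :: "int poly \<Rightarrow> real \<Rightarrow> real" where
  "ieval p x \<equiv> poly (map_poly of_int p) x"

lemma ieval_altdef: "ieval p x = (\<Sum>i\<le>degree p. of_int (coeff p i) * x ^ i)"
  by (simp add: poly_altdef coeff_map_poly)

lemma ieval_eq_sum_lessThan:
  assumes "degree p < d"
  shows "ieval p x = (\<Sum>i<d. of_int (coeff p i) * x ^ i)"
  unfolding ieval_altdef using assms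
  by (intro sum.mono_neutral_left) (auto simp: coeff_eq_0)

text \<open>Gauss's lemma by pseudo-division: the remainder vanishes by minimality of the degree,
  and as \<open>P\<close> is primitive, the factor \<open>a\<close> divides the content of the
  quotient and cancels.\<close>

lemma is_min_int_poly_dvd:
  fixes x :: real
  assumes P: "is_min_int_poly P x" and F: "ieval F x = 0"
  shows "P dvd F"
proof -
  have nz: "P \<noteq> 0" using P by (auto simp: is_min_int_poly_def)
  define r where "r = pseudo_mod F P"
  obtain a q where a: "a \<noteq> 0" and eq: "Polynomial.smult a F = P * q + r" and r: "r = 0 \<or> degree r < degree P"
    using pseudo_mod[OF nz, of F] unfolding r_def by blast
  have "r = Polynomial.smult a F - P * q" using eq by simp
  hence "ieval r x = 0"
    using F P by (simp add: is_min_int_poly_def of_int_poly_hom.hom_minus of_int_hom.map_poly_hom_smult of_int_poly_hom.hom_mult)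
  hence "r = 0" using r P by (auto simp: is_min_int_poly_def)
  hence eq': "Polynomial.smult a F = P * q" using eq by simp
  have "content (Polynomial.smult a F) = content q"
    using P by (simp add: eq' content_mult is_min_int_poly_def)
  hence "a dvd content q" by (metis content_smult dvd_def dvd_normalize_iff normalize_dvd_iff dvd_triv_left mult.commute)
  then obtain q' where q': "q = Polynomial.smult a q'"
    by (metis const_poly_dvd_iff_dvd_content dvdE mult_pCons_left add.right_neutral pCons_0_0 mult_zero_left)
  have "Polynomial.smult a (F - P * q') = 0" using eq' q' by (simp add: smult_diff_right)
  hence "F = P * q'" using a by simp
  thus ?thesis by simp
qed

text \<open>A witness that \<open>x\<close> is an algebraic integer of degree
  \<open>degree f\<close>. Minimality is stated through degrees alone, the form in which lower
  bounds on degrees use it.\<close>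

definition is_monic_min_poly :: "int poly \<Rightarrow> real \<Rightarrow> bool" where
  "is_monic_min_poly f x \<longleftrightarrow> lead_coeff f = 1 \<and> ieval f x = 0 \<and>
     (\<forall>q. q \<noteq> 0 \<and> ieval q x = 0 \<longrightarrow> degree f \<le> degree q)"

lemma algebraic_ieval:
  assumes "f \<noteq> 0" "ieval f x = 0"
  shows "algebraic x"
proof (rule algebraicI)
  show "coeff (map_poly of_int f :: real poly) i \<in> \<int>" for i
    by (simp add: coeff_map_poly)
qed (use assms in auto)

text \<open>The Eisenstein criterion at 2, applied to the factorization \<open>f = P * R\<close>
  with \<open>P\<close> the minimal polynomial of \<open>x\<close>. Exactly one of the two constant
  terms is even, and the factor with the even one must have full degree.\<close>

lemma eisenstein2:
  fixes f :: "int poly" and x :: real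
  assumes monic: "lead_coeff f = 1" and ev: "\<And>i. i < degree f \<Longrightarrow> even (coeff f i)"
    and c0: "\<not> 4 dvd coeff f 0" and d: "degree f \<ge> 1" and root: "ieval f x = 0"
  shows "is_monic_min_poly f x"
proof -
  have aux: "degree P \<ge> degree f"
    if fPR: "f = P * R" and P0: "even (coeff P 0)" and R0: "odd (coeff R 0)" for P R :: "int poly"
  proof -
    have "lead_coeff P * lead_coeff R = 1" using monic by (simp add: fPR lead_coeff_mult)
    hence "odd (lead_coeff P)" by (metis dvd_mult2 odd_one)
    hence ex: "odd (coeff P (degree P))" .
    \<comment> \<open>At the least index with an odd coefficient of \<open>P\<close>, the only odd
      summand of \<open>coeff f i\<close> is \<open>coeff P i * coeff R 0\<close>. So
      \<open>coeff f i\<close> is odd, which the hypothesis excludes below the leading term.\<close>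
    define i where "i = (LEAST i. odd (coeff P i))"
    have i: "odd (coeff P i)" unfolding i_def using ex by (rule LeastI[where P = "\<lambda>i. odd (coeff P i)"])
    have less: "even (coeff P j)" if "j < i" for j
      using not_less_Least[of j "\<lambda>i. odd (coeff P i)"] that unfolding i_def by blast
    have "coeff f i = (\<Sum>j\<le>i. coeff P j * coeff R (i - j))" by (simp add: fPR coeff_mult)
    also have "\<dots> = coeff P i * coeff R 0 + (\<Sum>j<i. coeff P j * coeff R (i - j))"
      by (subst lessThan_Suc_atMost[symmetric]) (simp add: add.commute)
    finally have "coeff f i = coeff P i * coeff R 0 + (\<Sum>j<i. coeff P j * coeff R (i - j))" .
    moreover have "even (\<Sum>j<i. coeff P j * coeff R (i - j))"
      using less by (intro dvd_sum) auto
    ultimately have "odd (coeff f i)" using i R0 by simp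
    hence "\<not> i < degree f" using ev by blast
    moreover have "i \<le> degree P" using i by (intro le_degree) auto
    ultimately show ?thesis by simp
  qed
  have nz: "f \<noteq> 0" using monic by auto
  have "algebraic x" by (rule algebraic_ieval[OF nz root])
  then obtain P where P: "is_min_int_poly P x" using is_min_int_poly_exists by blast
  obtain R where R: "f = P * R" using is_min_int_poly_dvd[OF P root] by (elim dvdE)
  have Pnz: "P \<noteq> 0" and Rnz: "R \<noteq> 0" using R nz by auto
  have Pd: "degree P > 0"
  proof (rule ccontr)
    assume "\<not> degree P > 0"
    then obtain c where "P = [:c:]" by (auto elim: degree_eq_zeroE)
    thus False using P by (auto simp: is_min_int_poly_def)
  qed
  have "even (coeff f 0)" using d ev by simp
  have c00: "coeff f 0 = coeff P 0 * coeff R 0" by (simp add: R coeff_mult)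
  have "degree P \<ge> degree f"
  proof (cases "even (coeff P 0)")
    case True
    hence "odd (coeff R 0)" using c0 c00 mult_dvd_mono[of 2 "coeff P 0" 2 "coeff R 0"] by auto
    thus ?thesis using aux[OF R] True by blast
  next
    case False
    hence "even (coeff R 0)" using \<open>even (coeff f 0)\<close> c00 by simp
    \<comment> \<open>This case is contradictory: \<open>R\<close> would have full degree although
      \<open>P\<close> has positive degree.\<close>
    hence "degree R \<ge> degree f" using aux[of R P] R False by (simp add: mult.commute)
    thus ?thesis using R Pd Pnz Rnz by (simp add: degree_mult_eq)
  qed
  thus ?thesis using P monic root unfolding is_monic_min_poly_def is_min_int_poly_def
    by (meson order_trans)
qed

section \<open>Rational dilations of integer polynomials\<close>

text \<open>This is \<open>P (a / b * x)\<close> multiplied by \<open>b ^ degree P\<close> to keep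
  the coefficients integral. Exchanging \<open>a\<close> and \<open>b\<close> reverses the dilation
  up to a constant factor.\<close>

definition scale_poly :: "int \<Rightarrow> int \<Rightarrow> int poly \<Rightarrow> int poly" where
  "scale_poly a b P = (\<Sum>i\<le>degree P. monom (coeff P i * a ^ i * b ^ (degree P - i)) i)"

lemma coeff_scale_poly: "coeff (scale_poly a b P) i = coeff P i * a ^ i * b ^ (degree P - i)"
proof (cases "i \<le> degree P")
  case True
  have "(\<Sum>k\<le>degree P. coeff (monom (coeff P k * a ^ k * b ^ (degree P - k)) k) i) =
        (\<Sum>k\<le>degree P. if k = i then coeff P k * a ^ k * b ^ (degree P - k) else 0)"
    by (intro sum.cong) auto
  with True show ?thesis by (simp add: scale_poly_def coeff_sum)
next
  case False
  thus ?thesis by (simp add: scale_poly_def coeff_sum coeff_eq_0)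
qed

lemma degree_scale_poly:
  assumes "a \<noteq> 0"
  shows "degree (scale_poly a b P) = degree P"
proof (cases "P = 0")
  case False
  show ?thesis
  proof (rule antisym)
    show "degree (scale_poly a b P) \<le> degree P"
      by (rule degree_le) (auto simp: coeff_scale_poly coeff_eq_0)
    show "degree P \<le> degree (scale_poly a b P)"
      using False assms by (intro le_degree) (simp add: coeff_scale_poly)
  qed
qed (simp add: scale_poly_def)

lemma ieval_scale_poly:
  assumes "a \<noteq> 0" "b \<noteq> 0"
  shows "ieval (scale_poly a b P) x = of_int b ^ degree P * ieval P (of_int a / of_int b * x)"
  unfolding ieval_altdef degree_scale_poly[OF assms(1)] sum_distrib_left
proof (rule sum.cong)
  fix i assume "i \<in> {..degree P}"
  hence "(of_int b :: real) ^ degree P = of_int b ^ i * of_int b ^ (degree P - i)"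
    by (simp add: power_add[symmetric])
  thus "of_int (coeff (scale_poly a b P) i) * x ^ i =
        of_int b ^ degree P * (of_int (coeff P i) * (of_int a / of_int b * x) ^ i)"
    using assms by (simp add: coeff_scale_poly power_mult_distrib power_divide field_simps)
qed simp

lemma scale_poly_eq_0_iff: "a \<noteq> 0 \<Longrightarrow> b \<noteq> 0 \<Longrightarrow> scale_poly a b P = 0 \<longleftrightarrow> P = 0"
  by (simp add: poly_eq_iff coeff_scale_poly)

section \<open>Height bounds and finiteness\<close>

lemma abs_coeff_le_alg_height:
  assumes "algebraic x"
  shows "\<bar>coeff (min_int_poly x) i\<bar> \<le> alg_height x"
proof -
  let ?P = "min_int_poly x"
  have nz: "?P \<noteq> 0" using min_int_poly[OF assms] by (auto simp: is_min_int_poly_def)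
  have *: "\<bar>coeff ?P i\<bar> \<le> alg_height x" if "i \<le> degree ?P" for i
    unfolding alg_height_def using that nz
    by (intro Max_ge) (auto simp: coeffs_def less_Suc_eq_le image_image simp del: upt_Suc)
  show ?thesis
    \<comment> \<open>Above the degree the coefficient is 0; the instance at 0 then supplies
      nonnegativity of the height.\<close>
    using *[of i] *[of 0] by (cases "i \<le> degree ?P") (auto simp: coeff_eq_0)
qed

lemma alg_height_ge_1:
  assumes "algebraic x"
  shows "alg_height x \<ge> 1"
proof -
  have "lead_coeff (min_int_poly x) > 0"
    using min_int_poly[OF assms] by (auto simp: is_min_int_poly_def)
  thus ?thesis using abs_coeff_le_alg_height[OF assms, of "degree (min_int_poly x)"] by linarith
qed

lemma alg_height_le:
  assumes "algebraic x" "\<And>i. \<bar>coeff (min_int_poly x) i\<bar> \<le> B"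
  shows "alg_height x \<le> B"
proof -
  have nz: "min_int_poly x \<noteq> 0" using min_int_poly[OF assms(1)] by (auto simp: is_min_int_poly_def)
  show ?thesis unfolding alg_height_def
    using nz assms(2) by (subst Max_le_iff) (auto simp: coeffs_def)
qed

text \<open>Finiteness in the style of Northcott: the bounds leave finitely many coefficient lists,
  and each nonzero polynomial has finitely many roots.\<close>

lemma finite_bounded_degree_height:
  "finite {x :: real. algebraic x \<and> alg_degree x = n \<and> alg_height x \<le> B}"
proof -
  define S where "S = Poly ` {xs. set xs \<subseteq> {-B..B} \<and> length xs = Suc n}"
  have "finite S" unfolding S_def by (intro finite_imageI finite_lists_length_eq) auto
  moreover have "{x :: real. algebraic x \<and> alg_degree x = n \<and> alg_height x \<le> B} \<subseteq>
      (\<Union>P\<in>S - {0}. {x. ieval P x = 0})"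
  proof safe
    fix x :: real assume x: "algebraic x" "alg_height x \<le> B" "n = alg_degree x"
    let ?P = "min_int_poly x"
    have P: "?P \<noteq> 0" "ieval ?P x = 0" using min_int_poly[OF x(1)] by (auto simp: is_min_int_poly_def)
    have "set (coeffs ?P) \<subseteq> {-B..B}"
    proof
      fix c assume "c \<in> set (coeffs ?P)"
      then obtain i where "c = coeff ?P i" by (auto simp: coeffs_def split: if_splits)
      thus "c \<in> {-B..B}" using abs_coeff_le_alg_height[OF x(1), of i] x(2) by auto
    qed
    moreover have "length (coeffs ?P) = Suc (alg_degree x)"
      using P by (simp add: length_coeffs alg_degree_def)
    ultimately have "?P \<in> Poly ` {xs. set xs \<subseteq> {-B..B} \<and> length xs = Suc (alg_degree x)}"
      by (intro image_eqI[of _ _ "coeffs ?P"]) auto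
    thus "x \<in> (\<Union>P\<in>S - {0}. {x. ieval P x = 0})" using P unfolding S_def x(3) by blast
  qed
  moreover have "finite (\<Union>P\<in>S - {0}. {x. ieval P x = 0})"
    using \<open>finite S\<close> by (intro finite_UN_I poly_roots_finite) auto
  ultimately show ?thesis using finite_subset by blast
qed

text \<open>Dilating annihilating polynomials in both directions shows that the degree is preserved.
  The dilated \<open>f\<close> is then a nonzero integer multiple of the minimal polynomial of
  \<open>y\<close>, whose coefficients can only be smaller.\<close>

lemma degree_height_rational_multiple:
  fixes a b B :: int and x :: real
  assumes f: "is_monic_min_poly f x" and ab: "a > 0" "b > 0"
    and B: "\<And>i. \<bar>coeff f i\<bar> * b ^ i * a ^ (degree f - i) \<le> B"
  defines "y \<equiv> of_int a / of_int b * x"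
  shows "algebraic y" "alg_degree y = degree f" "alg_height y \<le> B"
proof -
  define g where "g = scale_poly b a f"
  have f0: "f \<noteq> 0" using f by (auto simp: is_monic_min_poly_def)
  have g0: "g \<noteq> 0" using f0 ab by (simp add: g_def scale_poly_eq_0_iff)
  have dg: "degree g = degree f" using ab by (simp add: g_def degree_scale_poly)
  have "of_int b / of_int a * y = x" using ab by (simp add: y_def)
  hence gy: "ieval g y = 0" using f ab by (simp add: g_def ieval_scale_poly is_monic_min_poly_def)
  show alg: "algebraic y" by (rule algebraic_ieval[OF g0 gy])
  define P where "P = min_int_poly y"
  have P: "is_min_int_poly P y" unfolding P_def by (rule min_int_poly[OF alg])
  have "degree P \<le> degree f" using P g0 gy dg by (force simp: is_min_int_poly_def)
  moreover have "degree f \<le> degree P"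
  proof -
    have "ieval (scale_poly a b P) x = 0"
      using P ab by (simp add: ieval_scale_poly is_min_int_poly_def y_def)
    moreover have "scale_poly a b P \<noteq> 0" using P ab by (simp add: scale_poly_eq_0_iff is_min_int_poly_def)
    ultimately have "degree f \<le> degree (scale_poly a b P)" using f by (simp add: is_monic_min_poly_def)
    thus ?thesis using ab by (simp add: degree_scale_poly)
  qed
  ultimately have dP: "degree P = degree f" by simp
  thus "alg_degree y = degree f" by (simp add: alg_degree_def P_def)
  obtain R where R: "g = P * R" using is_min_int_poly_dvd[OF P gy] by (elim dvdE)
  have "degree R = 0" using dP dg g0 R by (auto simp: degree_mult_eq)
  then obtain c where c: "R = [:c:]" by (auto elim: degree_eq_zeroE)
  have "c \<noteq> 0" using c R g0 by auto
  show "alg_height y \<le> B"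
  proof (rule alg_height_le[OF alg])
    fix i
    have "\<bar>coeff P i\<bar> * 1 \<le> \<bar>coeff P i\<bar> * \<bar>c\<bar>"
      using \<open>c \<noteq> 0\<close> by (intro mult_left_mono) auto
    also have "\<dots> = \<bar>coeff g i\<bar>" by (simp add: R c abs_mult mult.commute)
    also have "\<dots> \<le> B" using B[of i] ab by (simp add: g_def coeff_scale_poly abs_mult)
    finally show "\<bar>coeff (min_int_poly y) i\<bar> \<le> B" by (simp add: P_def)
  qed
qed

section \<open>A lower bound for integer polynomials at an algebraic integer\<close>

text \<open>Because \<open>f\<close> is monic, \<open>x ^ degree f\<close> is an integral
  combination of lower powers; hence these span all powers over the integers.\<close>

lemma power_reduction:
  assumes monic: "lead_coeff f = 1" and root: "ieval f x = 0"
  shows "\<exists>e. x ^ N = (\<Sum>j<degree f. of_int (e j) * x ^ j)"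
proof (induction N rule: less_induct)
  case (less N)
  show ?case
  proof (cases "N < degree f")
    case True
    have "(\<Sum>j<degree f. of_int (if j = N then 1 else 0) * x ^ j) = (\<Sum>j<degree f. if j = N then x ^ j else 0)"
      by (intro sum.cong) auto
    also have "\<dots> = x ^ N" using True by simp
    finally show ?thesis by (intro exI[of _ "\<lambda>j. if j = N then 1 else 0"]) (rule sym)
  next
    case False
    let ?d = "degree f"
    have "\<forall>i\<in>{..<?d}. \<exists>e. x ^ (N - ?d + i) = (\<Sum>j<?d. of_int (e j) * x ^ j)"
      using less False by auto
    then obtain e where e: "\<And>i. i < ?d \<Longrightarrow> x ^ (N - ?d + i) = (\<Sum>j<?d. of_int (e i j) * x ^ j)"
      by (auto simp: bchoice_iff)
    have "ieval f x = (\<Sum>i<?d. of_int (coeff f i) * x ^ i) + x ^ ?d"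
      unfolding ieval_altdef lessThan_Suc_atMost[symmetric] using monic by simp
    hence xd: "x ^ ?d = (\<Sum>i<?d. - of_int (coeff f i) * x ^ i)"
      using root by (simp add: sum_negf)
    have "x ^ N = x ^ (N - ?d) * x ^ ?d" using False by (simp add: power_add[symmetric])
    also have "\<dots> = (\<Sum>i<?d. - of_int (coeff f i) * x ^ (N - ?d + i))"
      unfolding xd sum_distrib_left by (simp add: power_add algebra_simps)
    also have "\<dots> = (\<Sum>i<?d. \<Sum>j<?d. of_int (- coeff f i * e i j) * x ^ j)"
      by (intro sum.cong) (simp_all add: e sum_distrib_left mult.assoc)
    also have "\<dots> = (\<Sum>j<?d. of_int (\<Sum>i<?d. - coeff f i * e i j) * x ^ j)"
      by (subst sum.swap) (simp add: sum_distrib_right)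
    finally show ?thesis by (intro exI[of _ "\<lambda>j. \<Sum>i<?d. - coeff f i * e i j"])
  qed
qed

lemma abs_det_le:
  fixes A :: "int mat"
  assumes A: "A \<in> carrier_mat n n" and B: "\<And>i j. i < n \<Longrightarrow> j < n \<Longrightarrow> \<bar>A $$ (i,j)\<bar> \<le> B"
  shows "\<bar>det A\<bar> \<le> fact n * B ^ n"
proof -
  let ?P = "{p. p permutes {0..<n}}"
  have "\<bar>det A\<bar> \<le> (\<Sum>p\<in>?P. \<bar>signof p * (\<Prod>i = 0..<n. A $$ (i, p i))\<bar>)"
    unfolding det_def'[OF A] by (rule sum_abs)
  also have "\<dots> \<le> (\<Sum>p\<in>?P. B ^ n)"
  proof (rule sum_mono)
    fix p assume p: "p \<in> ?P"
    have "\<bar>signof p * (\<Prod>i = 0..<n. A $$ (i, p i))\<bar> = (\<Prod>i = 0..<n. \<bar>A $$ (i, p i)\<bar>)"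
      by (simp add: abs_mult abs_prod sign_def)
    also have "\<dots> \<le> (\<Prod>i = 0..<n. B)"
    proof (intro prod_mono conjI)
      fix i assume "i \<in> {0..<n}"
      moreover from this have "p i < n" using p permutes_in_image[of p "{0..<n}" i] by auto
      ultimately show "\<bar>A $$ (i, p i)\<bar> \<le> B" using B by auto
    qed auto
    finally show "\<bar>signof p * (\<Prod>i = 0..<n. A $$ (i, p i))\<bar> \<le> B ^ n" by simp
  qed
  also have "\<dots> = fact n * B ^ n" by (simp add: card_permutations[of _ n])
  finally show ?thesis .
qed

lemma index_mult_mat_vec_sum:
  assumes "A \<in> carrier_mat n n" "v \<in> carrier_vec n" "i < n"
  shows "(A *\<^sub>v v) $ i = (\<Sum>j<n. A $$ (i,j) * v $ j)"
  using assms by (auto simp: scalar_prod_def atLeast0LessThan intro!: sum.cong)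

text \<open>An eigenvector of each matrix that expresses multiplication by an element of the ring
  generated by \<open>x\<close> in the powers of \<open>x\<close>.\<close>

definition powers_vec :: "nat \<Rightarrow> real \<Rightarrow> real vec" where
  "powers_vec d x = vec d (\<lambda>i. x ^ i)"

lemma powers_vec_carrier [simp]: "powers_vec d x \<in> carrier_vec d"
  by (simp add: powers_vec_def)

lemma powers_vec_index [simp]: "i < d \<Longrightarrow> powers_vec d x $ i = x ^ i"
  by (simp add: powers_vec_def)

lemma independent_powers:
  assumes f: "is_monic_min_poly f x" and 0: "(\<Sum>i<degree f. of_int (u i) * x ^ i) = 0" and "i < degree f"
  shows "u i = 0"
proof -
  define U where "U = (\<Sum>i<degree f. monom (u i) i)"
  have c: "coeff U j = (if j < degree f then u j else 0)" for j
    by (simp add: U_def coeff_sum)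
  have "U = 0"
  proof (rule ccontr)
    assume nz: "U \<noteq> 0"
    have d: "degree U < degree f"
      using nz assms(3) by (metis c leading_coeff_0_iff)
    have "ieval U x = 0" using 0 by (simp add: ieval_eq_sum_lessThan[OF d] c)
    thus False using f nz d by (auto simp: is_monic_min_poly_def)
  qed
  thus ?thesis using c[of i] assms(3) by simp
qed

text \<open>Multiplication by \<open>ieval Q x\<close> on \<open>\<int>[x]\<close> has an integer matrix \<open>M\<close> with \<open>M v = ieval Q x \<cdot> v\<close> for
  \<open>v = (1, x, x\<^sup>2, \<dots>)\<close>. Multiplying by the adjugate shows that the nonzero integer \<open>det M\<close> is \<open>ieval Q x\<close>
  times a quantity bounded by a constant multiple of \<open>H ^ (degree f - 1)\<close>.\<close>
lemma ieval_lower_bound: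
  assumes f: "is_monic_min_poly f x" and d: "degree f \<ge> 1"
  obtains c :: real where "c > 0"
    "\<And>Q H. Q \<noteq> 0 \<Longrightarrow> degree Q < degree f \<Longrightarrow> (\<And>i. \<bar>coeff Q i\<bar> \<le> H) \<Longrightarrow>
        \<bar>ieval Q x\<bar> \<ge> c / of_int H ^ (degree f - 1)"
proof -
  define n where "n = degree f"
  have monic: "lead_coeff f = 1" and root: "ieval f x = 0" using f by (auto simp: is_monic_min_poly_def)
  obtain e where e: "\<And>N. x ^ N = (\<Sum>j<n. of_int (e N j) * x ^ j)"
    using power_reduction[OF monic root] unfolding n_def by metis
  \<comment> \<open>\<open>K\<close> collects all reduction coefficients that can enter
    \<open>M\<close>, so it is independent of \<open>Q\<close> and \<open>K * H\<close> bounds every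
    entry.\<close>
  define K where "K = (\<Sum>l<n. \<Sum>i<n. \<Sum>j<n. \<bar>e (l + i) j\<bar>)"
  define S where "S = (\<Sum>j<n. \<bar>x\<bar> ^ j)"
  have S: "S \<ge> 1"
  proof -
    have "(\<Sum>j\<in>{0}. \<bar>x\<bar> ^ j) \<le> S" unfolding S_def using d by (intro sum_mono2) (auto simp: n_def)
    thus ?thesis by simp
  qed
  have K0: "K \<ge> 0" unfolding K_def by (intro sum_nonneg) auto
  \<comment> \<open>The reciprocal of the cofactor bound with its power of \<open>H\<close> removed,
    times the bound \<open>S\<close> for the powers of \<open>x\<close>.\<close>
  define c where "c = 1 / (fact (n - 1) * (of_int K + 1) ^ (n - 1) * S)"
  have "c > 0" using S K0 unfolding c_def by (intro divide_pos_pos mult_pos_pos zero_less_power) auto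
  moreover have "\<bar>ieval Q x\<bar> \<ge> c / of_int H ^ (n - 1)"
    if Q: "Q \<noteq> 0" "degree Q < n" and H: "\<And>i. \<bar>coeff Q i\<bar> \<le> H" for Q H
  proof -
    have H1: "H \<ge> 1" using H[of "degree Q"] Q(1) by (smt (verit) leading_coeff_0_iff)
    define M where "M = mat n n (\<lambda>(i,j). \<Sum>l<n. coeff Q l * e (l + i) j)"
    have M: "M \<in> carrier_mat n n" by (simp add: M_def)
    define y where "y = ieval Q x"
    have row: "(\<Sum>j<n. of_int (M $$ (i,j)) * x ^ j) = y * x ^ i" if "i < n" for i
    proof -
      have "(\<Sum>j<n. of_int (M $$ (i,j)) * x ^ j) = (\<Sum>j<n. \<Sum>l<n. of_int (coeff Q l) * (of_int (e (l + i) j) * x ^ j))"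
        using that by (simp add: M_def sum_distrib_right mult.assoc)
      also have "\<dots> = (\<Sum>l<n. of_int (coeff Q l) * (\<Sum>j<n. of_int (e (l + i) j) * x ^ j))"
        by (subst sum.swap) (simp add: sum_distrib_left)
      also have "\<dots> = (\<Sum>l<n. of_int (coeff Q l) * x ^ (l + i))"
        by (simp only: e[symmetric])
      also have "\<dots> = y * x ^ i"
        by (simp add: y_def ieval_eq_sum_lessThan[OF Q(2)] sum_distrib_right power_add mult.assoc)
      finally show ?thesis .
    qed
    have y0: "y \<noteq> 0" using Q f by (auto simp: y_def is_monic_min_poly_def n_def)
    \<comment> \<open>A singular \<open>M\<close> would have a nonzero integer vector
      \<open>u\<close> in its left kernel. Pairing \<open>u\<close> with the row identities gives a
      linear relation among the powers of \<open>x\<close>, since \<open>y\<close> is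
      nonzero.\<close>
    have det0: "det M \<noteq> 0"
    proof
      assume "det M = 0"
      hence "det (transpose_mat M) = 0" using det_transpose[OF M] by simp
      then obtain u where u: "u \<in> carrier_vec n" "u \<noteq> 0\<^sub>v n" "transpose_mat M *\<^sub>v u = 0\<^sub>v n"
        using det_0_iff_vec_prod_zero[of "transpose_mat M" n] M by auto
      have col: "(\<Sum>i<n. M $$ (i,j) * u $ i) = 0" if "j < n" for j
      proof -
        have "(transpose_mat M *\<^sub>v u) $ j = (\<Sum>i<n. transpose_mat M $$ (j,i) * u $ i)"
          using M u that by (intro index_mult_mat_vec_sum) auto
        thus ?thesis using u M that by simp
      qed
      have "y * (\<Sum>i<n. of_int (u $ i) * x ^ i) = (\<Sum>i<n. of_int (u $ i) * (y * x ^ i))"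
        by (simp add: sum_distrib_left mult.left_commute)
      also have "\<dots> = (\<Sum>i<n. of_int (u $ i) * (\<Sum>j<n. of_int (M $$ (i,j)) * x ^ j))"
        by (intro sum.cong) (simp_all add: row)
      also have "\<dots> = (\<Sum>j<n. of_int (\<Sum>i<n. M $$ (i,j) * u $ i) * x ^ j)"
        unfolding sum_distrib_left by (subst sum.swap) (simp add: sum_distrib_left sum_distrib_right mult_ac)
      also have "\<dots> = 0" by (simp add: col)
      finally have "(\<Sum>i<degree f. of_int (u $ i) * x ^ i) = 0" using y0 by (simp add: n_def)
      hence "u $ i = 0" if "i < n" for i
        using independent_powers[OF f, of "\<lambda>i. u $ i"] that by (simp add: n_def)
      hence "u = 0\<^sub>v n" using u(1) by (intro eq_vecI) auto
      thus False using u by simp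
    qed
    have entry: "\<bar>M $$ (i,j)\<bar> \<le> (K + 1) * H" if "i < n" "j < n" for i j
    proof -
      have "\<bar>M $$ (i,j)\<bar> \<le> (\<Sum>l<n. \<bar>coeff Q l * e (l + i) j\<bar>)"
        using that by (simp add: M_def)
      also have "\<dots> \<le> (\<Sum>l<n. H * \<bar>e (l + i) j\<bar>)"
        using H by (intro sum_mono) (auto simp: abs_mult intro!: mult_right_mono)
      also have "\<dots> \<le> (\<Sum>l<n. H * (\<Sum>i<n. \<Sum>j<n. \<bar>e (l + i) j\<bar>))"
      proof (intro sum_mono mult_left_mono)
        fix l
        have "\<bar>e (l + i) j\<bar> \<le> (\<Sum>j<n. \<bar>e (l + i) j\<bar>)"
          using that by (intro member_le_sum) auto
        also have "\<dots> \<le> (\<Sum>i<n. \<Sum>j<n. \<bar>e (l + i) j\<bar>)"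
          using that by (intro member_le_sum[of i "{..<n}" "\<lambda>i. \<Sum>j<n. \<bar>e (l + i) j\<bar>"]) (auto intro: sum_nonneg)
        finally show "\<bar>e (l + i) j\<bar> \<le> (\<Sum>i<n. \<Sum>j<n. \<bar>e (l + i) j\<bar>)" .
      qed (use H1 in auto)
      also have "\<dots> = H * K" by (simp add: K_def sum_distrib_left)
      also have "\<dots> \<le> (K + 1) * H" using H1 by (simp add: algebra_simps)
      finally show ?thesis .
    qed
    define B where "B = fact (n - 1) * ((K + 1) * H) ^ (n - 1)"
    have cof: "\<bar>cofactor M j 0\<bar> \<le> B" if "j < n" for j
    proof -
      have "\<bar>det (mat_delete M j 0)\<bar> \<le> B"
        unfolding B_def
      proof (rule abs_det_le[OF mat_delete_carrier[OF M]])
        fix i' j' assume ij: "i' < n - 1" "j' < n - 1"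
        have "mat_delete M j 0 $$ (i', j') = M $$ (if i' < j then i' else Suc i', Suc j')"
          using ij M by (simp add: mat_delete_def)
        also have "\<bar>\<dots>\<bar> \<le> (K + 1) * H" using ij by (intro entry) auto
        finally show "\<bar>mat_delete M j 0 $$ (i', j')\<bar> \<le> (K + 1) * H" .
      qed
      thus ?thesis by (simp add: cofactor_def abs_mult power_abs)
    qed
    have n0: "0 < n" using d by (simp add: n_def)
    \<comment> \<open>Only row 0 of the adjugate is needed: as entry 0 of the vector of powers is 1,
      it isolates \<open>det M\<close>.\<close>
    have adj: "(\<Sum>i<n. cofactor M i 0 * M $$ (i,j)) = (if j = 0 then det M else 0)" if "j < n" for j
    proof -
      have "(adj_mat M * M) $$ (0, j) = (\<Sum>i<n. cofactor M i 0 * M $$ (i,j))"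
        using that M n0 by (auto simp: adj_mat_def scalar_prod_def atLeast0LessThan intro!: sum.cong)
      thus ?thesis using adj_mat(3)[OF M] that n0 by auto
    qed
    have "y * (\<Sum>i<n. of_int (cofactor M i 0) * x ^ i) = (\<Sum>i<n. of_int (cofactor M i 0) * (y * x ^ i))"
      by (simp add: sum_distrib_left mult.left_commute)
    also have "\<dots> = (\<Sum>i<n. of_int (cofactor M i 0) * (\<Sum>j<n. of_int (M $$ (i,j)) * x ^ j))"
      by (intro sum.cong) (simp_all add: row)
    also have "\<dots> = (\<Sum>j<n. of_int (\<Sum>i<n. cofactor M i 0 * M $$ (i,j)) * x ^ j)"
      unfolding sum_distrib_left by (subst sum.swap) (simp add: sum_distrib_left sum_distrib_right mult_ac)
    also have "\<dots> = (\<Sum>j<n. if j = 0 then of_int (det M) else 0)"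
      by (intro sum.cong) (auto simp: adj)
    also have "\<dots> = of_int (det M)" using n0 by simp
    finally have eq: "y * (\<Sum>i<n. of_int (cofactor M i 0) * x ^ i) = of_int (det M)" .
    have "\<bar>\<Sum>i<n. of_int (cofactor M i 0) * x ^ i\<bar> \<le> (\<Sum>i<n. \<bar>of_int (cofactor M i 0) * x ^ i\<bar>)"
      by (rule sum_abs)
    also have "\<dots> \<le> (\<Sum>i<n. of_int B * \<bar>x\<bar> ^ i)"
    proof (intro sum_mono)
      fix i assume "i \<in> {..<n}"
      hence "of_int \<bar>cofactor M i 0\<bar> \<le> (of_int B :: real)" by (subst of_int_le_iff) (use cof in auto)
      thus "\<bar>of_int (cofactor M i 0) * x ^ i\<bar> \<le> of_int B * \<bar>x\<bar> ^ i"
        by (simp add: abs_mult power_abs mult_right_mono)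
    qed
    also have "\<dots> = of_int B * S" by (simp add: S_def sum_distrib_left)
    finally have "\<bar>y\<bar> * \<bar>\<Sum>i<n. of_int (cofactor M i 0) * x ^ i\<bar> \<le> \<bar>y\<bar> * (of_int B * S)"
      by (intro mult_left_mono) auto
    moreover have "\<bar>y\<bar> * \<bar>\<Sum>i<n. of_int (cofactor M i 0) * x ^ i\<bar> = of_int \<bar>det M\<bar>"
      using eq by (simp add: abs_mult[symmetric])
    \<comment> \<open>The source of the lower bound: a nonzero integer has absolute value at least
      1.\<close>
    moreover have "(of_int \<bar>det M\<bar> :: real) \<ge> 1" using det0 by (subst of_int_1_le_iff) linarith
    ultimately have "1 \<le> \<bar>y\<bar> * (of_int B * S)" by linarith
    moreover have "c / of_int H ^ (n - 1) = 1 / (of_int B * S)"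
      by (simp add: c_def B_def power_mult_distrib)
    moreover have "of_int B * S > 0"
      using S K0 H1 unfolding B_def by (intro mult_pos_pos) auto
    ultimately show ?thesis by (simp add: y_def divide_le_eq)
  qed
  ultimately show ?thesis using that unfolding n_def by blast
qed

text \<open>Multiplication by \<open>x ^ k\<close> has an integer matrix in the powers of
  \<open>x\<close>. Its characteristic polynomial is monic of the right degree and has the
  eigenvalue \<open>x ^ k\<close> as a root.\<close>

lemma monic_annihilator_power:
  assumes monic: "lead_coeff f = 1" and root: "ieval f x = 0" and d: "degree f \<ge> 1"
  obtains g where "lead_coeff g = 1" "degree g = degree f" "ieval g (x ^ k) = 0"
proof -
  define n where "n = degree f"
  obtain e where e: "\<And>N. x ^ N = (\<Sum>j<n. of_int (e N j) * x ^ j)"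
    using power_reduction[OF monic root] unfolding n_def by metis
  define A :: "int mat" where "A = mat n n (\<lambda>(i,j). e (k + i) j)"
  define R :: "real mat" where "R = map_mat of_int A"
  have A: "A \<in> carrier_mat n n" and R: "R \<in> carrier_mat n n" by (simp_all add: A_def R_def)
  have "eigenvector R (powers_vec n x) (x ^ k)"
    unfolding eigenvector_def
  proof (intro conjI)
    show "powers_vec n x \<noteq> 0\<^sub>v (dim_row R)"
    proof
      assume "powers_vec n x = 0\<^sub>v (dim_row R)"
      hence "powers_vec n x $ 0 = 0" using d R by (simp add: n_def)
      thus False using d by (simp add: n_def)
    qed
    show "R *\<^sub>v powers_vec n x = x ^ k \<cdot>\<^sub>v powers_vec n x"
    proof (rule eq_vecI)
      fix i assume "i < dim_vec (x ^ k \<cdot>\<^sub>v powers_vec n x)"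
      hence i: "i < n" by (simp add: powers_vec_def)
      have "(R *\<^sub>v powers_vec n x) $ i = (\<Sum>j<n. R $$ (i,j) * powers_vec n x $ j)"
        using R i by (intro index_mult_mat_vec_sum) auto
      also have "\<dots> = x ^ (k + i)" using i by (simp add: R_def A_def e[of "k + i"])
      finally show "(R *\<^sub>v powers_vec n x) $ i = (x ^ k \<cdot>\<^sub>v powers_vec n x) $ i"
        using i by (simp add: powers_vec_def power_add)
    qed (use R in \<open>auto simp: powers_vec_def\<close>)
  qed (use R in auto)
  hence "poly (char_poly R) (x ^ k) = 0"
    using eigenvalue_root_char_poly[OF R] by (auto simp: eigenvalue_def)
  moreover have "char_poly R = map_poly of_int (char_poly A)"
    unfolding R_def by (rule of_int_hom.char_poly_hom[OF A])
  ultimately show ?thesis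
    using degree_monic_char_poly[OF A] that[of "char_poly A"] by (simp add: n_def)
qed

section \<open>Multiples of powers of a Liouville number\<close>

text \<open>Partial sums of a base 2 Liouville constant in which 0! and 1! both contribute 1/2. The
  integer shift \<open>t\<close> serves to produce infinitely many examples.\<close>

definition liouville_conv :: "nat \<Rightarrow> nat \<Rightarrow> real" where
  "liouville_conv t j = real t + (\<Sum>i\<le>j. 1 / 2 ^ fact i)"

definition liouville_num :: "nat \<Rightarrow> real" where
  "liouville_num t = real t + (\<Sum>i. 1 / 2 ^ fact i)"

text \<open>Lets the tail of the series be compared with a geometric one. At \<open>n = 0\<close>
  the claim fails because 0! = 1!.\<close>

lemma fact_add_le:
  assumes "n \<ge> 1"
  shows "fact n + m \<le> (fact (n + m) :: nat)"
proof (induction m)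
  case (Suc m)
  have "(1 :: nat) \<le> (n + m) * fact (n + m)"
    using assms by (metis One_nat_def Suc_leI add_gr_0 fact_gt_zero le_0_eq nat_0_less_mult_iff not_gr_zero zero_less_one)
  moreover have "fact (n + Suc m) = fact (n + m) + (n + m) * (fact (n + m) :: nat)" by simp
  ultimately show ?case using Suc by linarith
qed simp

lemma summable_liouville: "summable (\<lambda>i. 1 / 2 ^ fact i :: real)"
proof (rule summable_comparison_test)
  show "\<exists>N. \<forall>n\<ge>N. norm (1 / 2 ^ fact n :: real) \<le> (1 / 2) ^ n"
    by (auto simp: power_divide divide_simps intro!: exI[of _ 0] power_increasing fact_ge_self)
qed (simp add: summable_geometric)

lemma liouville_num_minus_conv:
  "liouville_num t - liouville_conv t j = (\<Sum>i. 1 / 2 ^ fact (i + Suc j))"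
  using suminf_split_initial_segment[OF summable_liouville, of "Suc j"]
  by (simp add: liouville_num_def liouville_conv_def lessThan_Suc_atMost del: fact_Suc)

lemma liouville_conv_less: "liouville_conv t j < liouville_num t"
proof -
  have "(\<Sum>i. 1 / 2 ^ fact (i + Suc j) :: real) > 0"
    using summable_ignore_initial_segment[OF summable_liouville, of "Suc j"]
    by (intro suminf_pos) auto
  thus ?thesis using liouville_num_minus_conv[of t j] by linarith
qed

text \<open>The tail is at most its first term times a geometric series of sum 2, and
  \<open>2 ^ fact (Suc j)\<close> is the \<open>Suc j\<close>-th power of the denominator
  \<open>2 ^ fact j\<close>.\<close>

lemma liouville_num_minus_conv_le:
  "liouville_num t - liouville_conv t j \<le> 2 / (2 ^ fact j) ^ Suc j"
proof -
  have "(\<Sum>i. 1 / 2 ^ fact (i + Suc j) :: real) \<le> (\<Sum>i. 1 / 2 ^ fact (Suc j) * (1 / 2) ^ i)"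
  proof (intro suminf_le)
    fix i
    have "(2 :: real) ^ (fact (Suc j) + i) \<le> 2 ^ fact (Suc j + i)"
      by (intro power_increasing fact_add_le) auto
    hence "1 / (2 :: real) ^ fact (Suc j + i) \<le> 1 / 2 ^ (fact (Suc j) + i)"
      by (intro divide_left_mono) auto
    thus "1 / (2 :: real) ^ fact (i + Suc j) \<le> 1 / 2 ^ fact (Suc j) * (1 / 2) ^ i"
      by (simp add: power_add power_divide add.commute mult.commute del: fact_Suc)
    show "summable (\<lambda>i. 1 / 2 ^ fact (i + Suc j) :: real)"
      using summable_ignore_initial_segment[OF summable_liouville, of "Suc j"] .
    show "summable (\<lambda>i. 1 / 2 ^ fact (Suc j) * (1 / 2) ^ i :: real)"
      by (intro summable_mult summable_geometric) auto
  qed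
  also have "\<dots> = 2 / 2 ^ fact (Suc j)"
    by (subst suminf_mult) (simp_all add: summable_geometric suminf_geometric del: fact_Suc)
  finally show ?thesis
    by (simp only: liouville_num_minus_conv fact_Suc power_mult[symmetric] mult.commute of_nat_id)
qed

lemma strict_mono_liouville_conv: "strict_mono (liouville_conv t)"
  by (simp add: strict_mono_Suc_iff liouville_conv_def)

lemma liouville_conv_pos: "liouville_conv t j > 0"
  unfolding liouville_conv_def by (intro add_nonneg_pos sum_pos) auto

lemma liouville_num_ge_1: "liouville_num t \<ge> 1"
proof -
  have "1 \<le> liouville_conv t 1" by (simp add: liouville_conv_def)
  thus ?thesis using liouville_conv_less[of t 1] by linarith
qed

lemma liouville_conv_fraction: "\<exists>p :: nat. liouville_conv t j = real p / 2 ^ fact j"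
proof (induction j)
  case 0
  have "liouville_conv t 0 = real (2 * t + 1) / 2 ^ fact 0"
    by (simp add: liouville_conv_def field_simps)
  thus ?case by blast
next
  case (Suc j)
  then obtain p :: nat where p: "liouville_conv t j = real p / 2 ^ fact j" by blast
  obtain m where m: "fact (Suc j) = fact j + (m :: nat)"
    using fact_mono_nat[of j "Suc j"] le_Suc_ex by auto
  have "liouville_conv t (Suc j) = liouville_conv t j + 1 / 2 ^ fact (Suc j)"
    by (simp add: liouville_conv_def del: fact_Suc)
  also have "\<dots> = real (p * 2 ^ m + 1) / 2 ^ fact (Suc j)"
    unfolding p m by (simp add: power_add field_simps)
  finally show ?case by blast
qed

text \<open>The index is minimal subject to the first bound, which yields the second one because
  \<open>2 ^ fact j = (2 ^ fact (j - 1)) ^ j\<close>.\<close>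
lemma gap_choice:
  fixes D :: real and A :: nat
  obtains C :: real where "C > 0" "\<And>Y. Y \<ge> 1 \<Longrightarrow>
    \<exists>j\<ge>A. (2 ^ fact j) ^ (Suc j - A) \<ge> D * Y \<and> 2 ^ fact j \<le> C * Y ^ Suc A"
proof -
  define q :: "nat \<Rightarrow> real" where "q j = 2 ^ fact j" for j
  have q1: "q j \<ge> 1" for j by (simp add: q_def)
  \<comment> \<open>The first argument serves a minimal index with \<open>i = 0\<close>, the second
    all later ones.\<close>
  define C where "C = max (q (Suc A)) (\<bar>D\<bar> ^ Suc A)"
  have C: "q (Suc A) \<le> C" "\<bar>D\<bar> ^ Suc A \<le> C" by (simp_all add: C_def)
  have C0: "C > 0" using C(1) q1[of "Suc A"] by linarith
  have "\<exists>j\<ge>A. q j ^ (Suc j - A) \<ge> D * Y \<and> q j \<le> C * Y ^ Suc A" if Y: "Y \<ge> 1" for Y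
  proof -
    \<comment> \<open>The search runs over \<open>j = Suc A + i\<close>, for which
      \<open>Suc j - A\<close> is \<open>i + 2\<close>.\<close>
    let ?P = "\<lambda>i. q (Suc A + i) ^ (i + 2) \<ge> D * Y"
    obtain i0 where i0: "D * Y < 2 ^ i0" using real_arch_pow[of 2 "D * Y"] by auto
    have "(2 :: real) ^ i0 \<le> q (Suc A + i0) ^ (i0 + 2)"
    proof -
      have "(2 :: real) ^ i0 \<le> 2 ^ (fact (Suc A + i0) * (i0 + 2))"
        using mult_le_mono[OF fact_ge_1[of "Suc A + i0"], of i0 "i0 + 2"]
        by (intro power_increasing) (simp_all del: fact_Suc)
      thus ?thesis by (simp only: q_def power_mult)
    qed
    hence ex: "?P i0" using i0 by linarith
    define i where "i = (LEAST i. ?P i)"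
    have i: "?P i" unfolding i_def by (rule LeastI[where P = ?P, OF ex])
    have "q (Suc A + i) \<le> C * Y ^ Suc A"
    proof (cases i)
      case 0
      have "q (Suc A) * 1 \<le> C * Y ^ Suc A"
        using C Y q1[of "Suc A"] C0 by (intro mult_mono one_le_power) auto
      thus ?thesis using 0 by simp
    next
      case (Suc i')
      have "\<not> ?P i'" using not_less_Least[of i' ?P] Suc unfolding i_def by auto
      hence less: "q (Suc A + i') ^ (i' + 2) \<le> \<bar>D\<bar> * Y"
        using Y by (smt (verit) mult_right_mono)
      have "fact (Suc A + i) = fact (Suc A + i') * (Suc A + i)" by (simp add: Suc algebra_simps)
      hence "q (Suc A + i) = q (Suc A + i') ^ (Suc A + i)" by (simp only: q_def power_mult)
      \<comment> \<open>With \<open>i = i' + 1\<close>, the exponent \<open>A + i' + 2\<close> is at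
        most \<open>(i' + 2) * (A + 1)\<close>. This produces a power of the quantity that failed
        the bound at \<open>i'\<close>.\<close>
      also have "\<dots> \<le> q (Suc A + i') ^ ((i' + 2) * Suc A)"
        using q1 Suc by (intro power_increasing) auto
      also have "\<dots> = (q (Suc A + i') ^ (i' + 2)) ^ Suc A" by (simp only: power_mult)
      also have "\<dots> \<le> (\<bar>D\<bar> * Y) ^ Suc A"
        using less q1[of "Suc A + i'"] by (intro power_mono) auto
      also have "\<dots> = \<bar>D\<bar> ^ Suc A * Y ^ Suc A" by (simp only: power_mult_distrib)
      also have "\<dots> \<le> C * Y ^ Suc A" using C Y by (intro mult_right_mono) auto
      finally show ?thesis .
    qed
    moreover have "Suc (Suc A + i) - A = i + 2" by simp
    ultimately show ?thesis using i by (intro exI[of _ "Suc A + i"]) auto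
  qed
  thus ?thesis using that C0 unfolding q_def by blast
qed

text \<open>Each \<open>x ^ i - y ^ i\<close> contains the factor \<open>x - y\<close>. With
  \<open>y\<close> a root of \<open>P\<close>, a lower bound for the value at \<open>x\<close>
  becomes one for the distance to \<open>y\<close>.\<close>

lemma abs_ieval_diff_le:
  fixes x y X H :: real
  assumes x: "\<bar>x\<bar> \<le> X" and y: "\<bar>y\<bar> \<le> X" and X: "X \<ge> 1" and H: "\<And>i. \<bar>of_int (coeff P i)\<bar> \<le> H"
  shows "\<bar>ieval P x - ieval P y\<bar> \<le> real (Suc (degree P)) * real (degree P) * X ^ degree P * H * \<bar>x - y\<bar>"
proof -
  let ?n = "degree P"
  have pow: "\<bar>x ^ i - y ^ i\<bar> \<le> real ?n * X ^ ?n * \<bar>x - y\<bar>" if "i \<le> ?n" for i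
  proof -
    have "\<bar>\<Sum>l<i. y ^ (i - Suc l) * x ^ l\<bar> \<le> (\<Sum>l<i. \<bar>y ^ (i - Suc l) * x ^ l\<bar>)" by (rule sum_abs)
    also have "\<dots> \<le> (\<Sum>l<i. X ^ ?n)"
    proof (rule sum_mono)
      fix l assume l: "l \<in> {..<i}"
      have "\<bar>y ^ (i - Suc l) * x ^ l\<bar> \<le> X ^ (i - Suc l) * X ^ l"
        unfolding abs_mult power_abs using x y X by (intro mult_mono power_mono) auto
      also have "\<dots> = X ^ (i - 1)" using l by (simp add: power_add[symmetric])
      also have "\<dots> \<le> X ^ ?n" using X that by (intro power_increasing) auto
      finally show "\<bar>y ^ (i - Suc l) * x ^ l\<bar> \<le> X ^ ?n" .
    qed
    also have "\<dots> = real i * X ^ ?n" by simp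
    also have "\<dots> \<le> real ?n * X ^ ?n" using that X by (intro mult_right_mono) auto
    finally have "\<bar>x - y\<bar> * \<bar>\<Sum>l<i. y ^ (i - Suc l) * x ^ l\<bar> \<le> \<bar>x - y\<bar> * (real ?n * X ^ ?n)"
      by (intro mult_left_mono) auto
    thus ?thesis by (simp add: power_diff_sumr2 abs_mult mult_ac)
  qed
  have H0: "H \<ge> 0" using H[of 0] by linarith
  have "ieval P x - ieval P y = (\<Sum>i\<le>?n. of_int (coeff P i) * (x ^ i - y ^ i))"
    by (simp add: ieval_altdef sum_subtractf right_diff_distrib)
  also have "\<bar>\<dots>\<bar> \<le> (\<Sum>i\<le>?n. \<bar>of_int (coeff P i) * (x ^ i - y ^ i)\<bar>)" by (rule sum_abs)
  also have "\<dots> \<le> (\<Sum>i\<le>?n. H * (real ?n * X ^ ?n * \<bar>x - y\<bar>))"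
    unfolding abs_mult using H pow H0 by (intro sum_mono mult_mono) auto
  also have "\<dots> = real (Suc ?n) * real ?n * X ^ ?n * H * \<bar>x - y\<bar>" by simp
  finally show ?thesis .
qed

text \<open>Factoring the difference of \<open>k\<close>-th powers shows that passing to powers
  costs only a constant factor.\<close>

lemma liouville_power_approx:
  assumes g: "\<gamma> > 0" and k: "k \<ge> 1"
  obtains C where "C > 0"
    "\<And>j. \<gamma> * liouville_num t ^ k - \<gamma> * liouville_conv t j ^ k \<le> C / (2 ^ fact j) ^ Suc j"
    "\<And>j. \<gamma> * liouville_conv t j ^ k < \<gamma> * liouville_num t ^ k"
proof -
  let ?L = "liouville_num t"
  define C where "C = \<gamma> * (2 * (real k * ?L ^ (k - 1)))"
  have L: "?L \<ge> 1" by (rule liouville_num_ge_1)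
  show ?thesis
  proof (rule that)
    show "C > 0" using g k L by (auto simp: C_def)
    fix j
    let ?r = "liouville_conv t j"
    have r: "?r > 0" "?r < ?L" by (rule liouville_conv_pos liouville_conv_less)+
    show "\<gamma> * ?r ^ k < \<gamma> * ?L ^ k"
      using g r k by (intro mult_strict_left_mono power_strict_mono) auto
    have "(\<Sum>i<k. ?r ^ (k - Suc i) * ?L ^ i) \<le> (\<Sum>i<k. ?L ^ (k - 1))"
    proof (rule sum_mono)
      fix i assume i: "i \<in> {..<k}"
      have "?r ^ (k - Suc i) * ?L ^ i \<le> ?L ^ (k - Suc i) * ?L ^ i"
        using r by (intro mult_right_mono power_mono) auto
      also have "\<dots> = ?L ^ (k - 1)" using i by (simp add: power_add[symmetric])
      finally show "?r ^ (k - Suc i) * ?L ^ i \<le> ?L ^ (k - 1)" .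
    qed
    hence s: "(\<Sum>i<k. ?r ^ (k - Suc i) * ?L ^ i) \<le> real k * ?L ^ (k - 1)" by simp
    have "?L ^ k - ?r ^ k = (?L - ?r) * (\<Sum>i<k. ?r ^ (k - Suc i) * ?L ^ i)" by (rule power_diff_sumr2)
    also have "\<dots> \<le> 2 / (2 ^ fact j) ^ Suc j * (real k * ?L ^ (k - 1))"
      using s r by (intro mult_mono liouville_num_minus_conv_le sum_nonneg) auto
    finally have "\<gamma> * (?L ^ k - ?r ^ k) \<le> \<gamma> * (2 / (2 ^ fact j) ^ Suc j * (real k * ?L ^ (k - 1)))"
      using g by (intro mult_left_mono) auto
    thus "\<gamma> * ?L ^ k - \<gamma> * ?r ^ k \<le> C / (2 ^ fact j) ^ Suc j"
      by (simp add: C_def algebra_simps)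
  qed
qed

text \<open>Numerator and denominator have the same order of magnitude, so heights can be measured
  by the denominator alone.\<close>

lemma liouville_conv_power_fraction:
  obtains p :: nat where "p > 0" "\<gamma> * liouville_conv t j ^ k = of_int (int (p ^ k)) / of_int (2 ^ (fact j * k)) * \<gamma>"
    "real (p ^ k) \<le> liouville_num t ^ k * 2 ^ (fact j * k)"
proof -
  obtain p :: nat where p: "liouville_conv t j = real p / 2 ^ fact j" using liouville_conv_fraction by blast
  show ?thesis
  proof
    show "p > 0" using liouville_conv_pos[of t j] unfolding p by (auto intro: Nat.gr0I)
    have eq: "liouville_conv t j ^ k = real (p ^ k) / 2 ^ (fact j * k)"
      by (simp add: p power_divide power_mult)
    thus "\<gamma> * liouville_conv t j ^ k = of_int (int (p ^ k)) / of_int (2 ^ (fact j * k)) * \<gamma>" by simp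
    have "liouville_conv t j ^ k \<le> liouville_num t ^ k"
      using liouville_conv_less[of t j] liouville_conv_pos[of t j] by (intro power_mono) auto
    thus "real (p ^ k) \<le> liouville_num t ^ k * 2 ^ (fact j * k)"
      unfolding eq by (simp add: divide_le_eq)
  qed
qed

section \<open>Distance to numbers of smaller degree\<close>

text \<open>Every approximant \<open>x j\<close> keeps a distance from \<beta> that is polynomial in
  the height and in \<open>q j\<close>. A suitable \<open>j\<close> makes \<open>\<xi> - x j\<close>
  at most half of this distance while \<open>q j\<close> stays polynomial in the height, so the
  triangle inequality transfers the bound to \<xi>.\<close>

lemma liouville_power_dist_ge:
  assumes f: "is_monic_min_poly f \<gamma>" and g: "\<gamma> > 0" and k: "k \<ge> 1" and n: "1 \<le> n" "n < degree f"
  obtains c :: real and E :: nat where "c > 0"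
    "\<And>\<beta>. algebraic \<beta> \<Longrightarrow> alg_degree \<beta> = n \<Longrightarrow>
       \<bar>\<gamma> * liouville_num t ^ k - \<beta>\<bar> \<ge> c / of_int (alg_height \<beta>) ^ E"
proof -
  define d where "d = degree f"
  define L where "L = liouville_num t"
  define \<xi> where "\<xi> = \<gamma> * L ^ k"
  define q :: "nat \<Rightarrow> real" where "q j = 2 ^ fact j" for j
  define x where "x j = \<gamma> * liouville_conv t j ^ k" for j
  have q1: "q j \<ge> 1" for j by (simp add: q_def)
  have L1: "L \<ge> 1" by (simp add: L_def liouville_num_ge_1)
  have \<xi>0: "\<xi> > 0" using g L1 by (auto simp: \<xi>_def)
  obtain c0 where c0: "c0 > 0" and low: "\<And>Q H. Q \<noteq> 0 \<Longrightarrow> degree Q < d \<Longrightarrow> (\<And>i. \<bar>coeff Q i\<bar> \<le> H) \<Longrightarrow>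
        \<bar>ieval Q \<gamma>\<bar> \<ge> c0 / of_int H ^ (d - 1)"
    using ieval_lower_bound[OF f] n unfolding d_def by (metis le_trans less_imp_le)
  obtain C1 where C1: "C1 > 0" "\<And>j. \<xi> - x j \<le> C1 / q j ^ Suc j" "\<And>j. x j < \<xi>"
    using liouville_power_approx[OF g k, of t] unfolding \<xi>_def L_def q_def x_def by metis
  \<comment> \<open>The denominator is \<open>q j ^ k\<close>; it enters with exponent
    \<open>n * (d - 1)\<close> from the value bound and \<open>n\<close> from clearing
    denominators.\<close>
  define A where "A = k * n * d"
  \<comment> \<open>An integer above \<open>L ^ k\<close>, so that \<open>a \<le> T * b\<close> can
    be stated among integers.\<close>
  define T where "T = nat \<lceil>L ^ k\<rceil>"
  have T: "real T \<ge> L ^ k" unfolding T_def by linarith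
  have T1: "T \<ge> 1" using T one_le_power[OF L1, of k] by linarith
  define X where "X = \<xi> + 1"
  define K where "K = real (Suc n) * real n * X ^ n"
  have K0: "K > 0" using n \<xi>0 by (auto simp: K_def X_def)
  define c2 where "c2 = c0 / real T ^ (n * (d - 1)) / K"
  have c2: "c2 > 0" using c0 K0 T1 by (auto simp: c2_def)
  obtain C where C: "C > 0" "\<And>Y. Y \<ge> 1 \<Longrightarrow> \<exists>j\<ge>A. q j ^ (Suc j - A) \<ge> (2 * C1 / c2) * Y \<and> q j \<le> C * Y ^ Suc A"
    using gap_choice[of A "2 * C1 / c2"] unfolding q_def by metis
  \<comment> \<open>The exponent of the height in \<open>Y * q j ^ A\<close> after inserting
    \<open>q j \<le> C * Y ^ Suc A\<close> and \<open>Y = h ^ d\<close>.\<close>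
  define E where "E = d + d * Suc A * A"
  define c where "c = min 1 (c2 / (2 * C ^ A))"
  show ?thesis
  proof (rule that)
    show "c > 0" using c2 C by (auto simp: c_def)
    fix \<beta> :: real assume alg: "algebraic \<beta>" and deg: "alg_degree \<beta> = n"
    define P where "P = min_int_poly \<beta>"
    define h where "h = alg_height \<beta>"
    have P: "P \<noteq> 0" "ieval P \<beta> = 0" "degree P = n"
      using min_int_poly[OF alg] deg by (auto simp: P_def is_min_int_poly_def alg_degree_def)
    have Ph: "\<bar>coeff P i\<bar> \<le> h" for i using abs_coeff_le_alg_height[OF alg] by (simp add: P_def h_def)
    have h1: "h \<ge> 1" using alg_height_ge_1[OF alg] by (simp add: h_def)
    have "\<bar>\<xi> - \<beta>\<bar> \<ge> c / of_int h ^ E"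
    \<comment> \<open>At distance at least 1 the bound \<open>c \<le> 1\<close> suffices; otherwise
      \<beta> lies in the range where the Lipschitz estimate with \<open>X\<close> applies.\<close>
    proof (cases "\<bar>\<xi> - \<beta>\<bar> < 1")
      case False
      have "c / of_int h ^ E \<le> 1 / 1" using h1 by (intro frac_le) (auto simp: c_def)
      thus ?thesis using False by simp
    next
      case True
      \<comment> \<open>Clearing denominators in \<open>P (x j)\<close> gives the value at \<gamma>
        of a nonzero integer polynomial of degree \<open>n < d\<close>, which cannot be too
        small.\<close>
      have conv: "\<bar>x j - \<beta>\<bar> \<ge> c2 / (of_int h ^ d * q j ^ A)" for j
      proof -
        obtain p :: nat where p: "p > 0" "x j = of_int (int (p ^ k)) / of_int (2 ^ (fact j * k)) * \<gamma>"
          "real (p ^ k) \<le> L ^ k * 2 ^ (fact j * k)"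
          using liouville_conv_power_fraction[of \<gamma> t j k] unfolding x_def L_def by metis
        define a where "a = int (p ^ k)"
        define b :: int where "b = 2 ^ (fact j * k)"
        have a0: "a > 0" and b0: "b > 0" using p by (auto simp: a_def b_def)
        have bq: "of_int b = q j ^ k" by (simp add: b_def q_def power_mult)
        have "real_of_int a \<le> L ^ k * of_int b" using p(3) by (simp add: a_def b_def)
        also have "\<dots> \<le> real T * of_int b" using T b0 by (intro mult_right_mono) auto
        finally have "real_of_int a \<le> of_int (int T * b)" by simp
        hence aT: "a \<le> int T * b" by (subst (asm) of_int_le_iff)
        define Q where "Q = scale_poly a b P"
        have "\<bar>ieval Q \<gamma>\<bar> \<ge> c0 / of_int (h * (int T * b) ^ n) ^ (d - 1)"
        proof (rule low)
          show "Q \<noteq> 0" using P a0 b0 by (simp add: Q_def scale_poly_eq_0_iff)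
          show "degree Q < d" using P a0 n by (simp add: Q_def degree_scale_poly d_def)
          fix i
          show "\<bar>coeff Q i\<bar> \<le> h * (int T * b) ^ n"
          proof (cases "i \<le> n")
            case True
            have "\<bar>coeff Q i\<bar> = \<bar>coeff P i\<bar> * (a ^ i * b ^ (n - i))"
              using a0 b0 P by (simp add: Q_def coeff_scale_poly abs_mult)
            also have "\<dots> \<le> h * ((int T * b) ^ i * (int T * b) ^ (n - i))"
              using Ph a0 b0 aT h1 T1 by (intro mult_mono power_mono) auto
            also have "\<dots> = h * (int T * b) ^ n" using True by (simp add: power_add[symmetric])
            finally show ?thesis .
          next
            case False
            thus ?thesis using P h1 b0 by (simp add: Q_def coeff_scale_poly coeff_eq_0)
          qed
        qed
        moreover have "ieval Q \<gamma> = of_int b ^ n * ieval P (x j)"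
          using a0 b0 P p by (simp add: Q_def ieval_scale_poly a_def b_def)
        moreover have "ieval P (x j) = ieval P (x j) - ieval P \<beta>" using P by simp
        moreover have "\<bar>ieval P (x j) - ieval P \<beta>\<bar> \<le> K * of_int h * \<bar>x j - \<beta>\<bar>"
        proof -
          have "x j > 0" using g liouville_conv_pos[of t j] by (simp add: x_def)
          hence "\<bar>x j\<bar> \<le> X" "\<bar>\<beta>\<bar> \<le> X" "X \<ge> 1" using C1(3)[of j] True \<xi>0 by (auto simp: X_def)
          moreover have "\<bar>real_of_int (coeff P i)\<bar> \<le> of_int h" for i
            using Ph[of i] by (metis of_int_abs of_int_le_iff)
          ultimately show ?thesis using abs_ieval_diff_le[of "x j" X \<beta> P "of_int h"] P by (simp add: K_def)
        qed
        ultimately have "c0 / of_int (h * (int T * b) ^ n) ^ (d - 1) \<le> of_int b ^ n * (K * of_int h * \<bar>x j - \<beta>\<bar>)"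
          using b0 by (simp add: abs_mult) (smt (verit) mult_left_mono of_int_pos zero_less_power)
        hence *: "c0 / (real T ^ (n * (d - 1)) * (of_int h ^ (d - 1) * of_int b ^ (n * (d - 1))))
                \<le> of_int b ^ n * (K * of_int h * \<bar>x j - \<beta>\<bar>)"
          by (simp add: power_mult_distrib power_mult mult_ac)
        have "c2 / (of_int h ^ d * q j ^ A) =
              c0 / (real T ^ (n * (d - 1)) * (of_int h ^ (d - 1) * of_int b ^ (n * (d - 1)))) / (of_int b ^ n * (K * of_int h))"
        proof -
          have d: "d = Suc (d - 1)" using n by (simp add: d_def)
          have "q j ^ A = of_int b ^ (n * d)" by (simp add: bq A_def power_mult)
          also have "n * d = n * (d - 1) + n" by (subst d) simp
          finally have qA: "q j ^ A = of_int b ^ (n * (d - 1)) * of_int b ^ n" by (simp add: power_add)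
          have hd: "(of_int h :: real) ^ d = of_int h * of_int h ^ (d - 1)" by (subst d) simp
          show ?thesis unfolding qA hd c2_def by (simp add: field_simps)
        qed
        also have "\<dots> \<le> \<bar>x j - \<beta>\<bar>"
          using * b0 K0 h1 by (subst pos_divide_le_eq) (auto simp: mult_ac)
        finally show ?thesis .
      qed
      define Y :: real where "Y = of_int h ^ d"
      have Y1: "Y \<ge> 1" using h1 by (simp add: Y_def)
      obtain j where j: "j \<ge> A" "q j ^ (Suc j - A) \<ge> (2 * C1 / c2) * Y" "q j \<le> C * Y ^ Suc A"
        using C(2)[OF Y1] by blast
      have qj: "q j ^ Suc j = q j ^ A * q j ^ (Suc j - A)" using j(1) by (simp add: power_add[symmetric])
      \<comment> \<open>The first property of \<open>j\<close> makes the approximation error at most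
        half of the distance bound for \<open>x j\<close>.\<close>
      have "C1 / q j ^ Suc j \<le> c2 / (2 * (Y * q j ^ A))"
      proof -
        have "q j ^ A * (2 * C1 * Y) \<le> q j ^ A * (c2 * q j ^ (Suc j - A))"
          using j(2) c2 q1[of j] by (intro mult_left_mono) (auto simp: field_simps)
        thus ?thesis using q1[of j] Y1 unfolding qj by (simp add: divide_simps)
      qed
      hence "\<bar>\<xi> - \<beta>\<bar> \<ge> c2 / (Y * q j ^ A) - c2 / (2 * (Y * q j ^ A))"
        using conv[of j] C1(2,3)[of j] unfolding Y_def by linarith
      also have "c2 / (Y * q j ^ A) - c2 / (2 * (Y * q j ^ A)) = c2 / (2 * (Y * q j ^ A))"
        by (simp add: field_simps)
      finally have "\<bar>\<xi> - \<beta>\<bar> \<ge> c2 / (2 * (Y * q j ^ A))" .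
      moreover have "c2 / (2 * (Y * q j ^ A)) \<ge> c / of_int h ^ E"
      proof -
        have "Y * q j ^ A \<le> Y * (C * Y ^ Suc A) ^ A"
          using j(3) q1[of j] Y1 by (intro mult_left_mono power_mono) auto
        also have "\<dots> = C ^ A * of_int h ^ E"
          by (simp add: power_mult_distrib power_mult[symmetric] power_add[symmetric] Y_def E_def algebra_simps)
        finally have 0: "Y * q j ^ A \<le> C ^ A * of_int h ^ E" .
        have "c2 / (2 * (C ^ A * of_int h ^ E)) \<le> c2 / (2 * (Y * q j ^ A))"
        proof (intro divide_left_mono)
          have "real_of_int h ^ E > 0" "q j > 0" "Y > 0" using h1 Y1 q1[of j] by auto
          thus "0 < 2 * (C ^ A * of_int h ^ E) * (2 * (Y * q j ^ A))" using C(1) by simp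
        qed (use c2 0 in auto)
        moreover have "c / of_int h ^ E \<le> (c2 / (2 * C ^ A)) / of_int h ^ E"
          using h1 by (intro divide_right_mono) (auto simp: c_def)
        ultimately show ?thesis by simp
      qed
      ultimately show ?thesis by linarith
    qed
    thus "\<bar>\<gamma> * liouville_num t ^ k - \<beta>\<bar> \<ge> c / of_int (alg_height \<beta>) ^ E"
      by (simp add: \<xi>_def L_def h_def)
  qed
qed

section \<open>The exponents of the products\<close>

text \<open>With \<open>q = 2 ^ fact j\<close>, the approximant \<open>x j\<close> has height at
  most a constant times \<open>q ^ (k * d)\<close> but error at most a constant over
  \<open>q ^ Suc j\<close>. The latter exponent grows with \<open>j\<close>, so every
  \<open>w\<close> is eventually exceeded.\<close>

lemma omega_star_eq_infinity:
  assumes f: "is_monic_min_poly f \<gamma>" and g: "\<gamma> > 0" and k: "k \<ge> 1"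
  shows "omega_star (degree f) (\<gamma> * liouville_num t ^ k) = \<infinity>"
proof -
  define d where "d = degree f"
  define L where "L = liouville_num t"
  define \<xi> where "\<xi> = \<gamma> * L ^ k"
  define x where "x j = \<gamma> * liouville_conv t j ^ k" for j
  define F where "F = (\<Sum>i\<le>d. \<bar>coeff f i\<bar>)"
  define T where "T = nat \<lceil>L ^ k\<rceil>"
  have L1: "L \<ge> 1" by (simp add: L_def liouville_num_ge_1)
  have T: "real T \<ge> L ^ k" unfolding T_def by linarith
  have T1: "T \<ge> 1" using T one_le_power[OF L1, of k] by linarith
  have F: "\<bar>coeff f i\<bar> \<le> F" if "i \<le> d" for i
    unfolding F_def using that by (intro member_le_sum) auto
  have F0: "F > 0" using F[of d] f by (simp add: is_monic_min_poly_def d_def)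
  obtain C1 where C1: "C1 > 0" "\<And>j. \<xi> - x j \<le> C1 / (2 ^ fact j) ^ Suc j" "\<And>j. x j < \<xi>"
    using liouville_power_approx[OF g k, of t] unfolding \<xi>_def L_def x_def by metis
  define G where "G = F * int T ^ d"
  have G0: "G > 0" using F0 T1 by (simp add: G_def)
  have x: "algebraic (x j) \<and> alg_degree (x j) = d \<and> alg_height (x j) \<le> G * 2 ^ (fact j * (k * d))" for j
  proof -
    obtain p :: nat where p: "p > 0" "x j = of_int (int (p ^ k)) / of_int (2 ^ (fact j * k)) * \<gamma>"
      "real (p ^ k) \<le> L ^ k * 2 ^ (fact j * k)"
      using liouville_conv_power_fraction[of \<gamma> t j k] unfolding x_def L_def by metis
    define a where "a = int (p ^ k)"
    define b :: int where "b = 2 ^ (fact j * k)"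
    have a0: "a > 0" and b0: "b > 0" using p by (auto simp: a_def b_def)
    have "real_of_int a \<le> L ^ k * of_int b" using p(3) by (simp add: a_def b_def)
    also have "\<dots> \<le> real T * of_int b" using T b0 by (intro mult_right_mono) auto
    finally have "real_of_int a \<le> of_int (int T * b)" by simp
    hence aT: "a \<le> int T * b" by (subst (asm) of_int_le_iff)
    have bT: "b \<le> int T * b" using T1 b0 by simp
    have "\<bar>coeff f i\<bar> * b ^ i * a ^ (degree f - i) \<le> G * b ^ d" for i
    proof (cases "i \<le> d")
      case True
      have "\<bar>coeff f i\<bar> * (b ^ i * a ^ (d - i)) \<le> F * ((int T * b) ^ i * (int T * b) ^ (d - i))"
        using F[OF True] a0 b0 aT bT F0 by (intro mult_mono power_mono) auto
      also have "\<dots> = F * (int T * b) ^ d" using True by (simp add: power_add[symmetric])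
      also have "\<dots> = G * b ^ d" by (simp add: G_def power_mult_distrib)
      finally show ?thesis by (simp add: d_def mult.assoc)
    next
      case False
      thus ?thesis using G0 b0 by (simp add: coeff_eq_0 d_def)
    qed
    from degree_height_rational_multiple[OF f a0 b0 this]
    have "algebraic (x j)" "alg_degree (x j) = d" "alg_height (x j) \<le> G * b ^ d"
      by (simp_all add: p(2) a_def b_def d_def)
    thus ?thesis by (simp add: b_def power_mult mult.assoc)
  qed
  have inj: "inj x"
  proof (rule strict_mono_imp_inj_on)
    show "strict_mono x"
    proof (rule strict_monoI)
      fix i j :: nat assume "i < j"
      hence "liouville_conv t i < liouville_conv t j" using strict_mono_liouville_conv strict_monoD by blast
      thus "x i < x j" unfolding x_def using g k liouville_conv_pos[of t i]
        by (intro mult_strict_left_mono power_strict_mono) auto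
    qed
  qed
  have inf: "infinite {\<alpha> :: real. algebraic \<alpha> \<and> alg_degree \<alpha> = d \<and>
         0 < \<bar>\<xi> - \<alpha>\<bar> \<and> \<bar>\<xi> - \<alpha>\<bar> < real_of_int (alg_height \<alpha>) powr (- w - 1)}" (is "infinite ?S") for w :: real
  proof -
    \<comment> \<open>A natural number above \<open>w + 1\<close> replaces real exponents by
      ordinary powers.\<close>
    define W where "W = nat \<lceil>w\<rceil> + 1"
    have W: "w + 1 \<le> real W" by (simp add: W_def) linarith
    \<comment> \<open>As \<open>q \<ge> 2\<close>, the factor \<open>q ^ J\<close> absorbs all
      constants.\<close>
    obtain J where J: "C1 * of_int G ^ W < 2 ^ J" using real_arch_pow[of 2 "C1 * of_int G ^ W"] by auto
    have "x j \<in> ?S" if j: "j \<ge> J + k * d * W" for j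
    proof -
      define h where "h = alg_height (x j)"
      define q :: real where "q = 2 ^ fact j"
      have q2: "q \<ge> 2" using power_increasing[of 1 "fact j" "2 :: real"] by (simp add: q_def)
      have h1: "h \<ge> 1" using x[of j] alg_height_ge_1[of "x j"] by (simp add: h_def)
      have "real_of_int h \<le> of_int (G * 2 ^ (fact j * (k * d)))"
        unfolding of_int_le_iff h_def using x by blast
      hence hq: "real_of_int h \<le> of_int G * q ^ (k * d)" by (simp add: q_def power_mult)
      have "C1 * of_int h ^ W \<le> C1 * (of_int G * q ^ (k * d)) ^ W"
        using C1(1) h1 hq by (intro mult_left_mono power_mono) auto
      also have "\<dots> = (C1 * of_int G ^ W) * q ^ (k * d * W)"
        by (simp add: power_mult_distrib power_mult)
      also have "\<dots> < 2 ^ J * q ^ (k * d * W)"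
        using J q2 by (intro mult_strict_right_mono) auto
      also have "\<dots> \<le> q ^ J * q ^ (k * d * W)"
        using q2 by (intro mult_right_mono power_mono) auto
      also have "\<dots> = q ^ (J + k * d * W)" by (simp add: power_add)
      also have "\<dots> \<le> q ^ Suc j" using j q2 by (intro power_increasing) auto
      finally have "C1 / q ^ Suc j < 1 / of_int h ^ W"
        using q2 h1 by (simp add: divide_simps mult_ac)
      also have "1 / of_int h ^ W = real_of_int h powr (- real W)"
        using h1 by (simp add: powr_minus powr_realpow inverse_eq_divide)
      also have "\<dots> \<le> real_of_int h powr (- w - 1)"
        using h1 W by (intro powr_mono) auto
      finally show ?thesis using x C1(2,3)[of j] by (auto simp: h_def q_def)
    qed
    hence "x ` {J + k * d * W..} \<subseteq> ?S" by auto
    moreover have "infinite (x ` {J + k * d * W..})"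
      using inj by (subst finite_image_iff) (auto simp: inj_on_def infinite_Ici)
    ultimately show ?thesis using finite_subset by blast
  qed
  have "ereal B \<le> omega_star d \<xi>" for B :: real
  proof -
    \<comment> \<open>Taking the maximum with 1 ensures that the exponent is positive, hence
      admissible.\<close>
    have "ereal (max B 1) \<le> omega_star d \<xi>"
      unfolding omega_star_def using inf by (intro Sup_upper insertI2 imageI) auto
    thus ?thesis by (rule order_trans[rotated]) simp
  qed
  hence "omega_star d \<xi> = \<infinity>" by (rule ereal_top)
  thus ?thesis by (simp add: d_def \<xi>_def L_def)
qed

text \<open>For smaller degrees, an exponent \<open>w > E\<close> combined with the distance bound
  forces the height below \<open>1 / c\<close>, leaving only finitely many approximations.\<close>

lemma U_number_mult_liouville_power:
  assumes f: "is_monic_min_poly f \<gamma>" and g: "\<gamma> > 0" and k: "k \<ge> 1" and d1: "degree f \<ge> 1"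
  shows "U_number (degree f) (\<gamma> * liouville_num t ^ k)"
  unfolding U_number_def
proof (intro conjI allI impI)
  let ?\<xi> = "\<gamma> * liouville_num t ^ k"
  fix n assume n: "1 \<le> n \<and> n < degree f"
  obtain c E where c: "c > 0" and dist: "\<And>\<beta>. algebraic \<beta> \<Longrightarrow> alg_degree \<beta> = n \<Longrightarrow>
       \<bar>?\<xi> - \<beta>\<bar> \<ge> c / of_int (alg_height \<beta>) ^ E"
    using liouville_power_dist_ge[OF f g k, of n t] n by metis
  have "w \<le> real E" if w: "infinite {\<alpha> :: real. algebraic \<alpha> \<and> alg_degree \<alpha> = n \<and>
         0 < \<bar>?\<xi> - \<alpha>\<bar> \<and> \<bar>?\<xi> - \<alpha>\<bar> < real_of_int (alg_height \<alpha>) powr (- w - 1)}" (is "infinite ?S") for w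
  proof (rule ccontr)
    assume "\<not> w \<le> real E"
    hence wE: "w > real E" by simp
    have "?S \<subseteq> {\<alpha>. algebraic \<alpha> \<and> alg_degree \<alpha> = n \<and> alg_height \<alpha> \<le> \<lceil>1 / c\<rceil>}"
    proof
      fix \<alpha> assume "\<alpha> \<in> ?S"
      hence a: "algebraic \<alpha>" "alg_degree \<alpha> = n"
        and less: "\<bar>?\<xi> - \<alpha>\<bar> < real_of_int (alg_height \<alpha>) powr (- w - 1)" by auto
      define h where "h = alg_height \<alpha>"
      have h1: "h \<ge> 1" using alg_height_ge_1[OF a(1)] by (simp add: h_def)
      have "c / of_int h ^ E < real_of_int h powr (- w - 1)"
        using dist[OF a] less unfolding h_def by linarith
      also have "\<dots> \<le> real_of_int h powr (- real (Suc E))"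
        using h1 wE by (intro powr_mono) auto
      also have "\<dots> = 1 / of_int h ^ Suc E"
        using h1 by (simp only: powr_minus, subst powr_realpow) (auto simp: inverse_eq_divide)
      finally have "c * of_int h < 1" using h1 by (simp add: divide_simps)
      hence "of_int h < 1 / c" using c by (simp add: field_simps)
      hence "h \<le> \<lceil>1 / c\<rceil>" by linarith
      thus "\<alpha> \<in> {\<alpha>. algebraic \<alpha> \<and> alg_degree \<alpha> = n \<and> alg_height \<alpha> \<le> \<lceil>1 / c\<rceil>}"
        using a by (simp add: h_def)
    qed
    thus False using w finite_bounded_degree_height finite_subset by blast
  qed
  \<comment> \<open>The inserted element 0 is covered because \<open>E\<close> is a natural
    number.\<close>
  hence "omega_star n ?\<xi> \<le> ereal (real E)"
    unfolding omega_star_def by (intro Sup_least) auto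
  thus "omega_star n ?\<xi> < \<infinity>" by (auto simp: less_top intro: le_less_trans)
qed (use omega_star_eq_infinity[OF f g k] d1 in auto)

section \<open>Algebraic integers whose powers have prescribed degree\<close>

lemma is_monic_min_poly_root_2:
  assumes "d \<ge> 1"
  shows "is_monic_min_poly (monom 1 d - [:2:]) (root d 2)" "degree (monom 1 d - [:2:] :: int poly) = d"
proof -
  define f :: "int poly" where "f = monom 1 d - [:2:]"
  have c: "coeff f i = (if i = d then 1 else 0) - (if i = 0 then 2 else 0)" for i
    by (simp add: f_def coeff_pCons split: nat.splits)
  have dg: "degree f = d"
    using assms by (intro antisym degree_le le_degree) (auto simp: c)
  have "(map_poly of_int f :: real poly) = monom 1 d - [:2:]"
    by (intro poly_eqI) (auto simp: coeff_map_poly c coeff_pCons split: nat.splits)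
  hence "ieval f (root d 2) = 0" using assms by (simp add: poly_monom)
  hence "is_monic_min_poly f (root d 2)"
    using assms dg by (intro eisenstein2) (auto simp: c)
  thus "is_monic_min_poly (monom 1 d - [:2:]) (root d 2)" "degree (monom 1 d - [:2:] :: int poly) = d"
    using dg by (simp_all only: f_def)
qed

section \<open>An algebraic integer whose powers all have the same degree\<close>

text \<open>A product of \<open>m\<close> well separated linear factors still has \<open>m\<close> real roots after subtracting 2,
  and the perturbation makes it Eisenstein at 2. Since the roots are positive, their \<open>k\<close>-th powers
  remain distinct, so raising a root to the \<open>k\<close>-th power preserves its degree.\<close>
definition pos_root_poly :: "nat \<Rightarrow> int poly" where
  "pos_root_poly m = (\<Prod>i\<in>{1..m}. [:- 8 * int i, 1:]) - [:2:]"

text \<open>The product of linear factors is a pure power of the variable modulo 8, so after the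
  subtraction the constant term is -2 modulo 8.\<close>

lemma pos_root_poly_eisenstein:
  assumes m: "m \<ge> 1"
  shows "degree (pos_root_poly m) = m" "lead_coeff (pos_root_poly m) = 1"
    "\<And>i. i < m \<Longrightarrow> even (coeff (pos_root_poly m) i)" "\<not> 4 dvd coeff (pos_root_poly m) 0"
proof -
  let ?g = "\<lambda>m. \<Prod>i\<in>{1..m}. [:- 8 * int i, 1:] :: int poly"
  have g: "degree (?g m) = m \<and> coeff (?g m) m = 1 \<and> (\<forall>i<m. 8 dvd coeff (?g m) i)" for m
  proof (induction m)
    case (Suc m)
    have eq: "?g (Suc m) = ?g m * [:- 8 * int (Suc m), 1:]" by simp
    have deg: "degree (?g (Suc m)) = Suc m"
      using Suc unfolding eq by (subst degree_mult_eq) auto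
    have c: "coeff (?g (Suc m)) i = - 8 * int (Suc m) * coeff (?g m) i + (if i = 0 then 0 else coeff (?g m) (i - 1))" for i
      unfolding eq by (simp add: coeff_pCons split: nat.splits)
    have "coeff (?g (Suc m)) (Suc m) = 1"
      unfolding c using Suc by (simp add: coeff_eq_0)
    moreover have "8 dvd coeff (?g (Suc m)) i" if "i < Suc m" for i
      unfolding c using Suc that by (intro dvd_add) auto
    ultimately show ?case using deg by blast
  qed simp
  have c: "coeff (pos_root_poly m) i = coeff (?g m) i - (if i = 0 then 2 else 0)" for i
    by (simp add: pos_root_poly_def coeff_pCons split: nat.splits)
  show deg: "degree (pos_root_poly m) = m"
    using g[of m] m c by (intro antisym degree_le le_degree) (auto simp: c coeff_eq_0)
  show "lead_coeff (pos_root_poly m) = 1" using m g[of m] by (simp add: deg c)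
  show "even (coeff (pos_root_poly m) i)" if "i < m" for i
  proof -
    have "8 dvd coeff (?g m) i" using g that by blast
    thus ?thesis unfolding c by presburger
  qed
  have "8 dvd coeff (?g m) 0" using g m by auto
  thus "\<not> 4 dvd coeff (pos_root_poly m) 0" unfolding c by presburger
qed

text \<open>At the points \<open>8 * j + 4\<close> the product alternates in sign with absolute
  value at least 4. Subtracting 2 preserves the signs, and the intermediate value theorem applies
  between neighbours.\<close>

lemma pos_root_poly_roots:
  assumes m: "m \<ge> 1" and i: "i < m"
  shows "\<exists>x. 8 * real i + 4 < x \<and> x < 8 * real i + 12 \<and> ieval (pos_root_poly m) x = 0"
proof -
  let ?F = "\<lambda>x :: real. \<Prod>l\<in>{1..m}. x - 8 * real l"
  have ev: "ieval (pos_root_poly m) x = ?F x - 2" for x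
    by (simp add: pos_root_poly_def of_int_poly_hom.hom_minus of_int_poly_hom.hom_prod poly_prod)
  \<comment> \<open>Exactly the \<open>m - j\<close> factors with \<open>l > j\<close> are negative,
    and each factor has absolute value at least 4.\<close>
  have F: "(-1) ^ (m - j) * ?F (8 * real j + 4) \<ge> 4" if "j \<le> m" for j
  proof -
    have "{1..m} = {1..j} \<union> {Suc j..m}" using that by auto
    hence "?F (8 * real j + 4) = (\<Prod>l\<in>{1..j}. 8 * real j + 4 - 8 * real l) * (\<Prod>l\<in>{Suc j..m}. 8 * real j + 4 - 8 * real l)"
      by (simp add: prod.union_disjoint)
    also have "(\<Prod>l\<in>{Suc j..m}. 8 * real j + 4 - 8 * real l) = (-1) ^ (m - j) * (\<Prod>l\<in>{Suc j..m}. 8 * real l - (8 * real j + 4))"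
      by (subst prod.cong[OF refl, of _ _ "\<lambda>l. (-1) * (8 * real l - (8 * real j + 4))"]) (simp_all only: prod.distrib, simp_all)
    finally have eq: "(-1) ^ (m - j) * ?F (8 * real j + 4) =
        (\<Prod>l\<in>{1..j}. 8 * real j + 4 - 8 * real l) * (\<Prod>l\<in>{Suc j..m}. 8 * real l - (8 * real j + 4))"
      by (simp add: power_mult_distrib[symmetric] mult.left_commute[of "(-1) ^ _"] mult.assoc[symmetric])
    have "(4 :: real) ^ 1 \<le> 4 ^ m" using m by (intro power_increasing) auto
    also have "(4 :: real) ^ m = (\<Prod>l\<in>{1..j}. 4) * (\<Prod>l\<in>{Suc j..m}. 4)"
      using that by (simp add: power_add[symmetric])
    also have "\<dots> \<le> (\<Prod>l\<in>{1..j}. 8 * real j + 4 - 8 * real l) * (\<Prod>l\<in>{Suc j..m}. 8 * real l - (8 * real j + 4))"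
      by (intro mult_mono prod_mono prod_nonneg) auto
    finally show ?thesis using eq by simp
  qed
  have "ieval (pos_root_poly m) (8 * real i + 4) * ieval (pos_root_poly m) (8 * real (Suc i) + 4) < 0"
  proof (cases "even (m - Suc i)")
    case True
    have "m - i = Suc (m - Suc i)" using i by simp
    thus ?thesis using True F[of i] F[of "Suc i"] i unfolding ev by (intro mult_neg_pos) auto
  next
    case False
    have "m - i = Suc (m - Suc i)" using i by simp
    thus ?thesis using False F[of i] F[of "Suc i"] i unfolding ev by (intro mult_pos_neg) auto
  qed
  from poly_IVT[OF _ this] show ?thesis by auto
qed

text \<open>A polynomial vanishing at the \<open>k\<close>-th power of one root of \<open>?f\<close>
  vanishes at the \<open>k\<close>-th powers of all \<open>m\<close> roots; this forces its degree
  up to \<open>m\<close>.\<close>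

lemma exists_powers_same_degree:
  assumes m: "m \<ge> 1"
  obtains \<alpha> :: real where "\<alpha> > 0"
    "\<And>k. k \<ge> 1 \<Longrightarrow> \<exists>g. is_monic_min_poly g (\<alpha> ^ k) \<and> degree g = m"
proof -
  let ?f = "pos_root_poly m"
  note f = pos_root_poly_eisenstein[OF m]
  obtain \<rho> where \<rho>: "\<And>i. i < m \<Longrightarrow> 8 * real i + 4 < \<rho> i \<and> \<rho> i < 8 * real i + 12 \<and> ieval ?f (\<rho> i) = 0"
    using pos_root_poly_roots[OF m] by metis
  have pos: "\<rho> i > 0" if "i < m" for i using \<rho>[OF that] by (smt (verit) of_nat_0_le_iff)
  have inj: "inj_on \<rho> {..<m}"
  proof (rule linorder_inj_onI')
    fix i j assume "i \<in> {..<m}" "j \<in> {..<m}" "i < j"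
    moreover from this have "8 * real i + 12 \<le> 8 * real j + 4" by simp
    ultimately have "\<rho> i < \<rho> j" using \<rho>[of i] \<rho>[of j] by simp
    thus "\<rho> i \<noteq> \<rho> j" by simp
  qed
  have wit: "is_monic_min_poly ?f (\<rho> i)" if "i < m" for i
    using f \<rho>[OF that] m by (intro eisenstein2) auto
  show ?thesis
  proof (rule that)
    show "\<rho> 0 > 0" using pos m by simp
    fix k :: nat assume k: "k \<ge> 1"
    obtain g where g: "lead_coeff g = 1" "degree g = m" "ieval g (\<rho> 0 ^ k) = 0"
      using monic_annihilator_power[of ?f "\<rho> 0" k] f \<rho>[of 0] m by auto
    have "m \<le> degree Q" if Q: "Q \<noteq> 0" "ieval Q (\<rho> 0 ^ k) = 0" for Q
    proof -
      \<comment> \<open>Composition with the \<open>k\<close>-th power turns the root of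
        \<open>Q\<close> into the root \<open>\<rho> 0\<close> of \<open>Qk\<close>, so
        \<open>P\<close> divides \<open>Qk\<close>.\<close>
      define Qk where "Qk = pcompose Q (monom 1 k)"
      have evQ: "ieval Qk y = ieval Q (y ^ k)" for y
        by (simp add: Qk_def of_int_hom.map_poly_pcompose poly_pcompose poly_monom)
      obtain P where P: "is_min_int_poly P (\<rho> 0)"
        using is_min_int_poly_exists algebraic_ieval[of ?f "\<rho> 0"] f \<rho>[of 0] m by force
      obtain R where R: "?f = P * R" using is_min_int_poly_dvd[OF P] \<rho>[of 0] m by (auto elim: dvdE)
      have "m \<le> degree P" using wit[of 0] P m f by (auto simp: is_monic_min_poly_def is_min_int_poly_def)
      \<comment> \<open>So \<open>P\<close> agrees with \<open>?f\<close> up to a constant and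
        shares all the roots \<open>\<rho> i\<close>.\<close>
      hence "degree R = 0" using R f by (metis add_le_same_cancel1 degree_mult_eq le_zero_eq leading_coeff_0_iff mult_zero_left mult_zero_right zero_neq_one)
      then obtain r where r: "R = [:r:]" by (auto elim: degree_eq_zeroE)
      have r0: "r \<noteq> 0" using R r f(2) by auto
      have fP: "?f = Polynomial.smult r P" using R r by simp
      have "ieval Qk (\<rho> 0) = 0" using Q evQ by simp
      then obtain S where S: "Qk = P * S" using is_min_int_poly_dvd[OF P] by (auto elim: dvdE)
      have "ieval Q (\<rho> i ^ k) = 0" if "i < m" for i
      proof -
        have "of_int r * ieval P (\<rho> i) = 0"
          using \<rho>[OF that] by (simp add: fP of_int_hom.map_poly_hom_smult)
        hence "ieval P (\<rho> i) = 0" using r0 by simp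
        hence "ieval Qk (\<rho> i) = 0" by (simp add: S of_int_poly_hom.hom_mult)
        thus ?thesis by (simp add: evQ)
      qed
      hence "(\<lambda>i. \<rho> i ^ k) ` {..<m} \<subseteq> {y. ieval Q y = 0}" by auto
      hence "card ((\<lambda>i. \<rho> i ^ k) ` {..<m}) \<le> card {y. ieval Q y = 0}"
        using Q by (intro card_mono poly_roots_finite) auto
      also have "\<dots> \<le> degree (map_poly of_int Q :: real poly)"
        using Q by (intro card_poly_roots_bound) auto
      also have "card ((\<lambda>i. \<rho> i ^ k) ` {..<m}) = m"
      proof (subst card_image)
        show "inj_on (\<lambda>i. \<rho> i ^ k) {..<m}"
        proof (rule inj_onI)
          fix i j assume ij: "i \<in> {..<m}" "j \<in> {..<m}" "\<rho> i ^ k = \<rho> j ^ k"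
          hence "\<rho> i = \<rho> j" using pos k by (intro power_eq_imp_eq_base[of "\<rho> i" k "\<rho> j"]) (auto intro: less_imp_le)
          thus "i = j" using inj ij by (auto simp: inj_on_def)
        qed
      qed simp
      finally show ?thesis by simp
    qed
    thus "\<exists>g. is_monic_min_poly g (\<rho> 0 ^ k) \<and> degree g = m"
      using g by (auto simp: is_monic_min_poly_def)
  qed
qed

section \<open>The two infinite families\<close>

lemma infinite_liouville_multiples:
  assumes "\<alpha> > (0 :: real)" "\<And>t. P (\<alpha> * liouville_num t)"
  shows "infinite {\<xi>. P \<xi>}"
proof
  assume "finite {\<xi>. P \<xi>}"
  moreover have "range (\<lambda>t. \<alpha> * liouville_num t) \<subseteq> {\<xi>. P \<xi>}" using assms by auto
  ultimately have "finite (range (\<lambda>t. \<alpha> * liouville_num t))" using finite_subset by blast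
  moreover have "inj (\<lambda>t. \<alpha> * liouville_num t)"
    using assms(1) by (auto simp: inj_on_def liouville_num_def)
  ultimately show False using finite_imageD infinite_UNIV_nat by blast
qed

theorem corollary2:
  fixes m :: nat
  assumes "m \<ge> 1"
  shows "infinite {\<xi> :: real. U_number m \<xi> \<and>
           (\<forall>d. d > 0 \<and> d dvd m \<longrightarrow> (\<exists>k::nat. k \<ge> 1 \<and> U_number d (\<xi> ^ k)))} \<and>
         infinite {\<xi> :: real. U_number m \<xi> \<and> (\<forall>k::nat. k \<ge> 1 \<longrightarrow> U_number m (\<xi> ^ k))}"
proof
  \<comment> \<open>The exponent for a divisor \<open>d\<close> is the cofactor
    \<open>k = m / d\<close>, since \<open>root m 2 ^ k = root d 2\<close>.\<close>
  have U: "U_number d ((root m 2 * liouville_num t) ^ k)" if "m = d * k" for d k t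
  proof -
    have d: "d \<ge> 1" and k: "k \<ge> 1" using assms that by (auto intro!: Suc_leI Nat.gr0I)
    have "root m 2 ^ k = root d (2 :: real)"
      using d k that by (simp add: mult.commute[of d] real_root_mult_exp)
    thus ?thesis
      using U_number_mult_liouville_power[OF is_monic_min_poly_root_2(1)[OF d] _ k, of t] d
      by (simp add: is_monic_min_poly_root_2(2) power_mult_distrib)
  qed
  show "infinite {\<xi> :: real. U_number m \<xi> \<and>
           (\<forall>d. d > 0 \<and> d dvd m \<longrightarrow> (\<exists>k::nat. k \<ge> 1 \<and> U_number d (\<xi> ^ k)))}"
  proof (rule infinite_liouville_multiples)
    show "root m (2 :: real) > 0" using assms by simp
    show "U_number m (root m 2 * liouville_num t) \<and>
        (\<forall>d. d > 0 \<and> d dvd m \<longrightarrow> (\<exists>k\<ge>1. U_number d ((root m 2 * liouville_num t) ^ k)))" for t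
    proof (intro conjI allI impI)
      show "U_number m (root m 2 * liouville_num t)" using U[of m 1] by simp
      fix d assume "d > 0 \<and> d dvd m"
      then obtain k where k: "m = d * k" by (auto elim: dvdE)
      hence "k \<ge> 1" using assms by (auto intro!: Suc_leI Nat.gr0I)
      thus "\<exists>k\<ge>1. U_number d ((root m 2 * liouville_num t) ^ k)" using U[OF k] by blast
    qed
  qed
next
  obtain \<alpha> :: real where \<alpha>: "\<alpha> > 0"
    "\<And>k. k \<ge> 1 \<Longrightarrow> \<exists>g. is_monic_min_poly g (\<alpha> ^ k) \<and> degree g = m"
    using exists_powers_same_degree[OF assms] by metis
  have U: "U_number m ((\<alpha> * liouville_num t) ^ k)" if k: "k \<ge> 1" for k t
  proof -
    obtain g where g: "is_monic_min_poly g (\<alpha> ^ k)" "degree g = m" using \<alpha>(2)[OF k] by blast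
    show ?thesis
      using U_number_mult_liouville_power[OF g(1) _ k, of t] \<alpha>(1) g(2) assms by (simp add: power_mult_distrib)
  qed
  show "infinite {\<xi> :: real. U_number m \<xi> \<and> (\<forall>k::nat. k \<ge> 1 \<longrightarrow> U_number m (\<xi> ^ k))}"
    \<comment> \<open>The instance at 1 shows that the number itself, not only its powers, has type
      \<open>m\<close>.\<close>
    using U U[of 1] by (intro infinite_liouville_multiples[OF \<alpha>(1)]) auto
qed

end
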